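(* Let $\alpha\in\mathbb{N}_0$, $N>0$ and $n\in\mathbb{N}_0$. (i) Let $y_n(x)=p_nP_n^{\alpha,-1/2,0,2N}(x)$ with $p_n=P_{2n}^{\alpha,\alpha,N,N}(1)/P_n^{\alpha,-1/2,0,2N}(1)$. The substitution $x=2\xi^2-1$, $0\le\xi\le1$, in the associated Jacobi-type differential equation $$2N\big\{L_{2\alpha+4,x}^{\alpha,-1/2}-\Lambda_{2\alpha+4,n}^{\alpha,-1/2}\big\}y_n(x)+C_{\alpha,-1/2}\big\{L_{2,x}^{\alpha,-1/2}-\Lambda_{2,n}^{\alpha,-1/2}\big\}y_n(x)=0,\quad -1<x<1,$$ leads to the differential equation $$N\big\{L_{2\alpha+4,\xi}-\Lambda_{2\alpha+4,2n}\big\}u_n(\xi)+C_{\alpha}\big\{L_{2,\xi}^{\alpha,\alpha}-\Lambda_{2,2n}^{\alpha,\alpha}\big\}u_n(\xi)=0$$ for the even ultraspherical-type polynomials $u_n(\xi):=y_n(2\xi^2-1)=P_{2n}^{\alpha,\alpha,N,N}(\xi)$. (ii) Let $y_n(x)=q_nP_n^{\alpha,1/2,0,(4\alpha+6)N}(x)$ with $q_n=P_{2n+1}^{\alpha,\alpha,N,N}(1)/P_n^{\alpha,1/2,0,(4\alpha+6)N}(1)$. Under the same substitution $x=2\xi^2-1$, $0\le\xi\le 1$, and the transformation of the dependent variable $v_n(\xi)=\xi\,y_n(2\xi^2-1)$, the associated Jacobi-type differential equation $$(4\alpha+6)N\big\{L_{2\alpha+4,x}^{\alpha,1/2}-\Lambda_{2\alpha+4,n}^{\alpha,1/2}\big\}y_n(x)+C_{\alpha,1/2}\big\{L_{2,x}^{\alpha,1/2}-\Lambda_{2,n}^{\alpha,1/2}\big\}y_n(x)=0,\quad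 -1<x<1,$$ reduces to the differential equation $$N\big\{L_{2\alpha+4,\xi}-\Lambda_{2\alpha+4,2n+1}\big\}v_n(\xi)+C_{\alpha}\big\{L_{2,\xi}^{\alpha,\alpha}-\Lambda_{2,2n+1}^{\alpha,\alpha}\big\}v_n(\xi)=0$$ for the odd ultraspherical-type polynomials $v_n(\xi)=\xi\,y_n(2\xi^2-1)=P_{2n+1}^{\alpha,\alpha,N,N}(\xi)$. Here "leads to" and "reduces to" mean that, after the indicated change of variables, the left-hand side of the first equation at $x=2\xi^2-1$ equals the left-hand side of the second equation at $\xi$, up to a factor that does not vanish for $0<\xi<1$.
   Context: $\mathbb{N}=\{1,2,\dots\}$, $\mathbb{N}_0=\{0,1,2,\dots\}$; $(a)_k=a(a+1)\cdots(a+k-1)$, $(a)_0=1$; $D_x^i$ is $i$-fold differentiation with respect to $x$. Jacobi-type objects ($\alpha\in\mathbb{N}_0$, $\beta>-1$, mass $K>0$): the classical Jacobi polynomials are $P_n^{\alpha,\beta}(x)=\frac{(\alpha+1)_n}{n!}\,{}_2F_1\big(-n,n+\alpha+\beta+1;\alpha+1;\frac{1-x}{2}\big)$; the Jacobi-type polynomials are $P_n^{\alpha,\beta,0,K}(x)=P_n^{\alpha,\beta}(x)+K R_n^{\alpha,\beta}(x)$, where $R_0^{\alpha,\beta}(x)=0$ and, for $n\in\mathbb{N}$, $R_n^{\alpha,\beta}(x)=A_n^{\alpha,\beta}(x-1)P_{n-1}^{\alpha+2,\beta}(x)$ with $A_n^{\alpha,\beta}=\dfrac{(\alpha+2)_{n-1}(\alpha+\beta+2)_n}{2\,n!\,(\beta+1)_{n-1}}$.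 Moreover $$L_{2\alpha+4,x}^{\alpha,\beta}y(x)=\frac{x-1}{(x+1)^{\beta}}D_x^{\alpha+2}\Big\{(x+1)^{\alpha+\beta+2}D_x^{\alpha+2}\big[(x-1)^{\alpha+1}y(x)\big]\Big\},$$ $$L_{2,x}^{\alpha,\beta}y(x)=\big\{(x^2-1)D_x^2+[\alpha-\beta+(\alpha+\beta+2)x]D_x\big\}y(x),$$ $\Lambda_{2\alpha+4,n}^{\alpha,\beta}=(n)_{\alpha+2}(n+\beta)_{\alpha+2}$, $\Lambda_{2,n}^{\alpha,\beta}=n(n+\alpha+\beta+1)$, $C_{\alpha,\beta}=(\alpha+2)!\,(\beta+1)_{\alpha+1}$. Ultraspherical-type objects: $P_n^{\alpha,\alpha,N,N}$, $n\in\mathbb{N}_0$, is the polynomial of degree $n$ in the system of orthogonal polynomials on $[-1,1]$ with respect to the measure $w_{\alpha,\alpha}(x)\,dx+N\delta_{-1}+N\delta_{1}$, where $w_{\alpha,\alpha}(x)=h_{\alpha,\alpha}^{-1}(1-x^2)^{\alpha}$, $h_{\alpha,\alpha}=\int_{-1}^1(1-x^2)^\alpha dx$, and $\delta_{\pm1}$ are unit point masses at $\pm1$ (a fixed normalization of these polynomials is understood; its choice is immaterial here because of the factors $p_n,q_n$). Their differential equation involves $$L_{2\alpha+4,x}y(x)=(x^2-1)D_x^{2\alpha+4}\big[(x^2-1)^{\alpha+1}y(x)\big],\qquad L_{2,x}^{\alpha,\alpha}y(x)=\big\{(x^2-1)D_x^2+2(\alpha+1)xD_x\big\}y(x),$$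 $\Lambda_{2\alpha+4,n}=(n-1)_{2\alpha+4}$, $\Lambda_{2,n}^{\alpha,\alpha}=n(n+2\alpha+1)$, $C_\alpha=\frac12(\alpha+2)(2\alpha+2)!$. *)

theory Defs
  imports "HOL-Analysis.Analysis"
begin

definition hyp2F1 :: "real \<Rightarrow> real \<Rightarrow> real \<Rightarrow> real \<Rightarrow> real" where
  "hyp2F1 a b c z = eval_fps (fps_hypergeo [a, b] [c] 1) z"

definition jacobi_P :: "nat \<Rightarrow> real \<Rightarrow> nat \<Rightarrow> real \<Rightarrow> real" where
  "jacobi_P \<alpha> \<beta> n x =
     pochhammer (real \<alpha> + 1) n / fact n *
     hyp2F1 (- real n) (real n + real \<alpha> + \<beta> + 1) (real \<alpha> + 1) ((1 - x) / 2)"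

definition jacobi_A :: "nat \<Rightarrow> real \<Rightarrow> nat \<Rightarrow> real" where
  "jacobi_A \<alpha> \<beta> n =
     pochhammer (real \<alpha> + 2) (n - 1) * pochhammer (real \<alpha> + \<beta> + 2) n /
     (2 * fact n * pochhammer (\<beta> + 1) (n - 1))"

definition jacobi_R :: "nat \<Rightarrow> real \<Rightarrow> nat \<Rightarrow> real \<Rightarrow> real" where
  "jacobi_R \<alpha> \<beta> n x =
     (if n = 0 then 0 else jacobi_A \<alpha> \<beta> n * (x - 1) * jacobi_P (\<alpha> + 2) \<beta> (n - 1) x)"

text \<open>The Jacobi-type polynomials with superscripts \<open>\<alpha>, \<beta>, 0, K\<close>.\<close>

definition jacobi_type_P :: "nat \<Rightarrow> real \<Rightarrow> real \<Rightarrow> nat \<Rightarrow> real \<Rightarrow> real" where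
  "jacobi_type_P \<alpha> \<beta> K n x = jacobi_P \<alpha> \<beta> n x + K * jacobi_R \<alpha> \<beta> n x"

text \<open>The operator of order \<open>2\<alpha> + 4\<close>. Real powers are used, so it is meaningful for \<open>x > -1\<close>.\<close>

definition jacobi_L_high :: "nat \<Rightarrow> real \<Rightarrow> (real \<Rightarrow> real) \<Rightarrow> real \<Rightarrow> real" where
  "jacobi_L_high \<alpha> \<beta> y x =
     (x - 1) / (x + 1) powr \<beta> *
     (deriv ^^ (\<alpha> + 2))
       (\<lambda>t. (t + 1) powr (real \<alpha> + \<beta> + 2) *
             (deriv ^^ (\<alpha> + 2)) (\<lambda>s. (s - 1) ^ (\<alpha> + 1) * y s) t) x"

definition jacobi_L2 :: "nat \<Rightarrow> real \<Rightarrow> (real \<Rightarrow> real) \<Rightarrow> real \<Rightarrow> real" where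
  "jacobi_L2 \<alpha> \<beta> y x =
     (x\<^sup>2 - 1) * (deriv ^^ 2) y x +
     (real \<alpha> - \<beta> + (real \<alpha> + \<beta> + 2) * x) * deriv y x"

definition jacobi_Lambda_high :: "nat \<Rightarrow> real \<Rightarrow> nat \<Rightarrow> real" where
  "jacobi_Lambda_high \<alpha> \<beta> n =
     pochhammer (real n) (\<alpha> + 2) * pochhammer (real n + \<beta>) (\<alpha> + 2)"

definition jacobi_Lambda2 :: "nat \<Rightarrow> real \<Rightarrow> nat \<Rightarrow> real" where
  "jacobi_Lambda2 \<alpha> \<beta> n = real n * (real n + real \<alpha> + \<beta> + 1)"

definition jacobi_C :: "nat \<Rightarrow> real \<Rightarrow> real" where
  "jacobi_C \<alpha> \<beta> = fact (\<alpha> + 2) * pochhammer (\<beta> + 1) (\<alpha> + 1)"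

text \<open>The left-hand side of the Jacobi-type differential equation, for an arbitrary function \<open>y\<close>.\<close>

definition jacobi_type_lhs ::
  "nat \<Rightarrow> real \<Rightarrow> real \<Rightarrow> nat \<Rightarrow> (real \<Rightarrow> real) \<Rightarrow> real \<Rightarrow> real" where
  "jacobi_type_lhs \<alpha> \<beta> K n y x =
     K * (jacobi_L_high \<alpha> \<beta> y x - jacobi_Lambda_high \<alpha> \<beta> n * y x) +
     jacobi_C \<alpha> \<beta> * (jacobi_L2 \<alpha> \<beta> y x - jacobi_Lambda2 \<alpha> \<beta> n * y x)"

text \<open>
  The inner product of the measure \<open>h\<^sup>-\<^sup>1 (1 - x\<^sup>2)\<^sup>\<alpha> dx + N \<delta>\<^sub>-\<^sub>1 + N \<delta>\<^sub>1\<close> on \<open>[-1, 1]\<close>,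
  where \<open>h\<close> is the integral of \<open>(1 - x\<^sup>2)\<^sup>\<alpha>\<close>.
\<close>

definition ultra_weight :: "nat \<Rightarrow> real \<Rightarrow> real" where
  "ultra_weight \<alpha> x = (1 - x\<^sup>2) ^ \<alpha> / integral {-1..1} (\<lambda>t. (1 - t\<^sup>2) ^ \<alpha>)"

definition ultra_type_inner :: "nat \<Rightarrow> real \<Rightarrow> real poly \<Rightarrow> real poly \<Rightarrow> real" where
  "ultra_type_inner \<alpha> N p q =
     integral {-1..1} (\<lambda>x. poly p x * poly q x * ultra_weight \<alpha> x) +
     N * (poly p (-1) * poly q (-1)) + N * (poly p 1 * poly q 1)"

text \<open>
  Being a system of ultraspherical-type polynomials determines each \<open>P n\<close> up to a nonzero
  constant factor, that is, up to normalization. The condition \<open>P n \<noteq> 0\<close> is needed only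
  for \<open>n = 0\<close>, as the zero polynomial also has degree \<open>0\<close>.
\<close>

definition ultra_type_system :: "nat \<Rightarrow> real \<Rightarrow> (nat \<Rightarrow> real poly) \<Rightarrow> bool" where
  "ultra_type_system \<alpha> N P \<longleftrightarrow>
     (\<forall>n. P n \<noteq> 0 \<and> degree (P n) = n) \<and>
     (\<forall>m n. m \<noteq> n \<longrightarrow> ultra_type_inner \<alpha> N (P m) (P n) = 0)"

definition ultra_L_high :: "nat \<Rightarrow> (real \<Rightarrow> real) \<Rightarrow> real \<Rightarrow> real" where
  "ultra_L_high \<alpha> y x =
     (x\<^sup>2 - 1) * (deriv ^^ (2 * \<alpha> + 4)) (\<lambda>s. (s\<^sup>2 - 1) ^ (\<alpha> + 1) * y s) x"

definition ultra_L2 :: "nat \<Rightarrow> (real \<Rightarrow> real) \<Rightarrow> real \<Rightarrow> real" where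
  "ultra_L2 \<alpha> y x = (x\<^sup>2 - 1) * (deriv ^^ 2) y x + 2 * (real \<alpha> + 1) * x * deriv y x"

definition ultra_Lambda_high :: "nat \<Rightarrow> nat \<Rightarrow> real" where
  "ultra_Lambda_high \<alpha> n = pochhammer (real n - 1) (2 * \<alpha> + 4)"

definition ultra_Lambda2 :: "nat \<Rightarrow> nat \<Rightarrow> real" where
  "ultra_Lambda2 \<alpha> n = real n * (real n + 2 * real \<alpha> + 1)"

definition ultra_C :: "nat \<Rightarrow> real" where
  "ultra_C \<alpha> = 1 / 2 * (real \<alpha> + 2) * fact (2 * \<alpha> + 2)"

definition ultra_type_lhs :: "nat \<Rightarrow> real \<Rightarrow> nat \<Rightarrow> (real \<Rightarrow> real) \<Rightarrow> real \<Rightarrow> real" where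
  "ultra_type_lhs \<alpha> N n u x =
     N * (ultra_L_high \<alpha> u x - ultra_Lambda_high \<alpha> n * u x) +
     ultra_C \<alpha> * (ultra_L2 \<alpha> u x - ultra_Lambda2 \<alpha> n * u x)"

end

theory Submission
  imports Defs
begin

text \<open>
  The even and the odd case are treated together. The parameter \<open>\<epsilon>\<close> is \<open>0\<close> or \<open>1\<close>, the second
  Jacobi parameter is \<open>\<beta> = \<epsilon> - 1/2\<close>, the mass is \<open>K = 2 (2\<alpha> + 3)^\<epsilon> N\<close>, and a function \<open>y\<close> of
  \<open>x = 2\<xi>\<^sup>2 - 1\<close> corresponds to the function \<open>\<xi>^\<epsilon> y(2\<xi>\<^sup>2 - 1)\<close>.

  The differential equations. Put \<open>m = \<alpha> + 2\<close> and expand \<open>(x - 1)^(\<alpha>+1) f(x)\<close> in powers of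
  \<open>x + 1 = 2\<xi>\<^sup>2\<close>. Both operators of order \<open>2m\<close> act diagonally on such an expansion: apart from
  the common factor \<open>x - 1\<close>, the Jacobi-type operator multiplies \<open>(x + 1)^k\<close> by
  \<open>(k-m+1)\<^sub>m (k+\<beta>-m+1)\<^sub>m (x + 1)^(-m)\<close>, while \<open>D\<^sub>\<xi>^(2m)\<close> multiplies \<open>\<xi>^(2k+\<epsilon>)\<close> by
  \<open>(2k+\<epsilon>-2m+1)\<^sub>2\<^sub>m \<xi>^(-2m)\<close>. The duplication formula for Pochhammer symbols says that the two
  numerical factors differ by the factor \<open>4^m\<close>; it also matches the eigenvalues and the constants
  \<open>C\<close>. The operators of order two are compared by the chain rule. This gives
  \<open>jacobi_type_lhs_eq_ultra_type_lhs\<close> with an explicit factor.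

  The polynomials. Put \<open>t = (1 - x)/2 = 1 - \<xi>\<^sup>2\<close>. Against the normalized weight, \<open>t^j \<xi>^(2k)\<close>
  has the moment \<open>(\<alpha>+1)\<^sub>j (1/2)\<^sub>k / (\<alpha>+3/2)\<^sub>j\<^sub>+\<^sub>k\<close>, so orthogonality of the transformed Jacobi-type
  polynomial to \<open>\<xi>^(2k+\<epsilon>)\<close>, \<open>k < n\<close>, is a finite identity for its coefficients in powers of \<open>t\<close>.
  For the classical part the sum is an \<open>n\<close>-th finite difference of a polynomial in \<open>j\<close> of degree
  below \<open>n\<close>, hence zero. For the part with factor \<open>x - 1\<close> it is a finite difference of a
  polynomial divided by \<open>j + \<alpha> + 2\<close>; its value does not depend on \<open>k\<close> and cancels the
  contribution of the point masses (\<open>jacobi_type_poly_orthogonal\<close>). Monomials of the opposite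
  parity are orthogonal by symmetry, and a polynomial of degree at most \<open>d\<close> that is orthogonal to
  all lower degrees is a multiple of the \<open>d\<close>-th orthogonal polynomial (\<open>ultra_type_system_unique\<close>).
\<close>

section \<open>The two operators of order \<open>2\<alpha> + 4\<close>\<close>

text \<open>
  Real exponents cover the half-integer powers between the two differentiations of the Jacobi-type
  operator. The representation is only required on the half-line where real powers behave as powers;
  this suffices because the half-line is open.
\<close>

lemma higher_deriv_powr_sum:
  fixes b e :: "nat \<Rightarrow> real" and c x :: real
  assumes g: "\<And>s. s > - c \<Longrightarrow> g s = (\<Sum>k\<in>S. b k * (s + c) powr e k)"
    and x: "x > - c"
  shows "(deriv ^^ m) g x =
    (\<Sum>k\<in>S. b k * pochhammer (e k - real m + 1) m * (x + c) powr (e k - real m))"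
  using x
proof (induction m arbitrary: x)
  case 0
  then show ?case by (simp add: g)
next
  case (Suc m)
  let ?G = "\<lambda>x. \<Sum>k\<in>S. b k * pochhammer (e k - real m + 1) m * (x + c) powr (e k - real m)"
  have "eventually (\<lambda>s. s \<in> {- c<..}) (nhds x)"
    using Suc.prems by (intro eventually_nhds_in_open) auto
  then have ev: "eventually (\<lambda>s. (deriv ^^ m) g s = ?G s) (nhds x)"
    by eventually_elim (use Suc.IH in auto)
  have "(?G has_real_derivative
      (\<Sum>k\<in>S. b k * pochhammer (e k - real m + 1) m *
         ((e k - real m) * (x + c) powr (e k - real m - 1)))) (at x)"
    using Suc.prems by (auto intro!: derivative_eq_intros sum.cong)
  then have "deriv ?G x = (\<Sum>k\<in>S. b k * pochhammer (e k - real m + 1) m *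
         ((e k - real m) * (x + c) powr (e k - real m - 1)))"
    by (rule DERIV_imp_deriv)
  also have "\<dots> = (\<Sum>k\<in>S. b k * pochhammer (e k - real (Suc m) + 1) (Suc m) *
      (x + c) powr (e k - real (Suc m)))"
  proof (rule sum.cong)
    fix k
    have "pochhammer (e k - real (Suc m) + 1) (Suc m) =
        (e k - real m) * pochhammer (e k - real m + 1) m"
      by (subst pochhammer_rec) (simp add: algebra_simps)
    moreover have "(x + c) powr (e k - real (Suc m)) = (x + c) powr (e k - real m - 1)"
      by (simp add: algebra_simps)
    ultimately show "b k * pochhammer (e k - real m + 1) m *
         ((e k - real m) * (x + c) powr (e k - real m - 1)) =
        b k * pochhammer (e k - real (Suc m) + 1) (Suc m) * (x + c) powr (e k - real (Suc m))"
      by (simp only: mult_ac)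
  qed simp
  finally have "deriv ?G x = \<dots>" .
  moreover have "(deriv ^^ Suc m) g x = deriv ?G x"
    using deriv_cong_ev[OF ev refl] by simp
  ultimately show ?case by simp
qed

text \<open>
  Powers of \<open>x + 1\<close> are used because both the weight factor inside the Jacobi-type operator and the
  substitution \<open>x + 1 = 2\<xi>\<^sup>2\<close> turn each of them into another power.
\<close>

definition shifted_coeff :: "nat \<Rightarrow> real poly \<Rightarrow> nat \<Rightarrow> real" where
  "shifted_coeff \<alpha> f = coeff (pcompose ([:-1, 1:] ^ (\<alpha> + 1) * f) [:-1, 1:])"

definition shifted_degree :: "nat \<Rightarrow> real poly \<Rightarrow> nat" where
  "shifted_degree \<alpha> f = degree (pcompose ([:-1, 1:] ^ (\<alpha> + 1) * f) [:-1, 1:])"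

lemma shifted_expansion:
  "(s - 1) ^ (\<alpha> + 1) * poly f s =
     (\<Sum>k\<le>shifted_degree \<alpha> f. shifted_coeff \<alpha> f k * (s + 1) ^ k)"
proof -
  have "(\<Sum>k\<le>shifted_degree \<alpha> f. shifted_coeff \<alpha> f k * (s + 1) ^ k) =
      poly (pcompose ([:-1, 1:] ^ (\<alpha> + 1) * f) [:-1, 1:]) (s + 1)"
    unfolding shifted_degree_def shifted_coeff_def by (rule poly_altdef[symmetric])
  also have "\<dots> = (s - 1) ^ (\<alpha> + 1) * poly f s"
    by (simp add: poly_pcompose poly_power del: power_Suc)
  finally show ?thesis by simp
qed

text \<open>
  After the inner differentiation the factor \<open>(x + 1)^(\<alpha>+\<beta>+2)\<close> restores the powers lost and shifts
  all exponents by \<open>\<beta>\<close>, so the outer differentiation again acts on a sum of powers. Terms with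
  \<open>k < \<alpha> + 2\<close> have negative exponents but vanish, since then \<open>(k-\<alpha>-1)\<^sub>\<alpha>\<^sub>+\<^sub>2 = 0\<close>.
\<close>

lemma jacobi_L_high_poly:
  assumes "x > - 1"
  shows "jacobi_L_high \<alpha> \<beta> (poly f) x = (x - 1) *
    (\<Sum>k\<le>shifted_degree \<alpha> f. shifted_coeff \<alpha> f k *
       pochhammer (real k - real (\<alpha> + 2) + 1) (\<alpha> + 2) *
       pochhammer (real k + \<beta> - real (\<alpha> + 2) + 1) (\<alpha> + 2) *
       (x + 1) powr (real k - real (\<alpha> + 2)))"
proof -
  let ?m = "\<alpha> + 2"
  let ?b = "shifted_coeff \<alpha> f" and ?S = "{..shifted_degree \<alpha> f}"
  let ?p = "\<lambda>k. pochhammer (real k - real ?m + 1) ?m"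
  have expansion: "(s - 1) ^ (\<alpha> + 1) * poly f s = (\<Sum>k\<in>?S. ?b k * (s + 1) powr real k)"
    if "s > - 1" for s
    unfolding shifted_expansion using that by (intro sum.cong) (simp_all add: powr_realpow)
  have inner: "(deriv ^^ ?m) (\<lambda>s. (s - 1) ^ (\<alpha> + 1) * poly f s) t =
      (\<Sum>k\<in>?S. ?b k * ?p k * (t + 1) powr (real k - real ?m))" if "t > - 1" for t
    by (rule higher_deriv_powr_sum[OF expansion that])
  have "(t + 1) powr (real \<alpha> + \<beta> + 2) *
      (deriv ^^ ?m) (\<lambda>s. (s - 1) ^ (\<alpha> + 1) * poly f s) t =
      (\<Sum>k\<in>?S. ?b k * ?p k * (t + 1) powr (real k + \<beta>))" if "t > - 1" for t
    unfolding inner[OF that] sum_distrib_left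
  proof (rule sum.cong)
    fix k
    have "(t + 1) powr (real \<alpha> + \<beta> + 2) * (t + 1) powr (real k - real ?m) =
        (t + 1) powr (real k + \<beta>)"
    proof -
      have "real \<alpha> + \<beta> + 2 + (real k - real ?m) = real k + \<beta>" by simp
      then show ?thesis by (simp only: powr_add[symmetric])
    qed
    then show "(t + 1) powr (real \<alpha> + \<beta> + 2) * (?b k * ?p k * (t + 1) powr (real k - real ?m)) =
        ?b k * ?p k * (t + 1) powr (real k + \<beta>)"
      by (metis mult.left_commute)
  qed simp
  then have "(deriv ^^ ?m) (\<lambda>t. (t + 1) powr (real \<alpha> + \<beta> + 2) *
      (deriv ^^ ?m) (\<lambda>s. (s - 1) ^ (\<alpha> + 1) * poly f s) t) x =
      (\<Sum>k\<in>?S. ?b k * ?p k * pochhammer (real k + \<beta> - real ?m + 1) ?m *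
        (x + 1) powr (real k + \<beta> - real ?m))"
    using assms by (intro higher_deriv_powr_sum) auto
  moreover have "(x + 1) powr (real k + \<beta> - real ?m) / (x + 1) powr \<beta> =
      (x + 1) powr (real k - real ?m)" for k
  proof -
    have "real k + \<beta> - real ?m - \<beta> = real k - real ?m" by simp
    then show ?thesis by (simp only: powr_diff[symmetric])
  qed
  ultimately show ?thesis
    unfolding jacobi_L_high_def
    by (simp add: sum_distrib_left sum_divide_distrib times_divide_eq_right[symmetric]
        del: times_divide_eq_right pochhammer_Suc)
qed

lemma ultra_L_high_poly:
  assumes "\<xi> > 0"
  shows "ultra_L_high \<alpha> (\<lambda>s. s ^ \<epsilon> * poly f (2 * s\<^sup>2 - 1)) \<xi> = (\<xi>\<^sup>2 - 1) *
    (\<Sum>k\<le>shifted_degree \<alpha> f. shifted_coeff \<alpha> f k * 2 ^ k / 2 ^ (\<alpha> + 1) *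
       pochhammer (real (2 * k + \<epsilon>) - real (2 * \<alpha> + 4) + 1) (2 * \<alpha> + 4) *
       \<xi> powr (real (2 * k + \<epsilon>) - real (2 * \<alpha> + 4)))"
proof -
  have expansion: "(s\<^sup>2 - 1) ^ (\<alpha> + 1) * (s ^ \<epsilon> * poly f (2 * s\<^sup>2 - 1)) =
      (\<Sum>k\<le>shifted_degree \<alpha> f. shifted_coeff \<alpha> f k * 2 ^ k / 2 ^ (\<alpha> + 1) *
         (s + 0) powr (real (2 * k + \<epsilon>)))"
    if "s > - 0" for s :: real
  proof -
    have "(s\<^sup>2 - 1) ^ (\<alpha> + 1) * 2 ^ (\<alpha> + 1) = ((2 * s\<^sup>2 - 1) - 1) ^ (\<alpha> + 1)"
      by (simp only: power_mult_distrib[symmetric]) (simp add: algebra_simps)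
    then have "(s\<^sup>2 - 1) ^ (\<alpha> + 1) * (s ^ \<epsilon> * poly f (2 * s\<^sup>2 - 1)) =
        s ^ \<epsilon> * (((2 * s\<^sup>2 - 1) - 1) ^ (\<alpha> + 1) * poly f (2 * s\<^sup>2 - 1)) / 2 ^ (\<alpha> + 1)"
      by (simp add: field_simps del: power_Suc)
    also have "\<dots> = (\<Sum>k\<le>shifted_degree \<alpha> f. shifted_coeff \<alpha> f k * 2 ^ k / 2 ^ (\<alpha> + 1) *
         (s + 0) powr (real (2 * k + \<epsilon>)))"
      unfolding shifted_expansion sum_distrib_left sum_divide_distrib
      using that
      by (intro sum.cong refl)
        (simp only: powr_realpow, simp add: power_add power_mult power_mult_distrib del: power_Suc)
    finally show ?thesis .
  qed
  show ?thesis
    unfolding ultra_L_high_def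
    using higher_deriv_powr_sum[OF expansion, of "\<xi>" "2 * \<alpha> + 4"] assms by simp
qed

text \<open>
  Of the \<open>2m\<close> consecutive factors on the left, \<open>2z, 2z + 2, \<dots>\<close> make up \<open>2^m (z)\<^sub>m\<close>, and the
  others, which start one lower for \<open>\<epsilon> = 0\<close> and one higher for \<open>\<epsilon> = 1\<close>, make up \<open>2^m (z+\<beta>)\<^sub>m\<close>.
\<close>

lemma pochhammer_split_parity:
  fixes z \<beta> :: real
  assumes "\<beta> = real \<epsilon> - 1/2" "\<epsilon> \<le> 1"
  shows "pochhammer (2 * z + real \<epsilon> - 1) (2 * m) = 4 ^ m * (pochhammer z m * pochhammer (z + \<beta>) m)"
proof -
  have double: "pochhammer (2 * w) (2 * m) = 4 ^ m * (pochhammer w m * pochhammer (w + 1/2) m)"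
    for w :: real
    by (simp add: pochhammer_double power_mult)
  consider "\<epsilon> = 0" | "\<epsilon> = 1" using assms(2) by linarith
  then show ?thesis
  proof cases
    case 1
    then show ?thesis using double[of "z - 1/2"] assms(1) by (simp add: right_diff_distrib mult_ac)
  next
    case 2
    then have "\<beta> = 1/2" using assms(1) by simp
    then show ?thesis unfolding 2 by (simp only: double of_nat_1 diff_add_eq) (simp add: double)
  qed
qed

lemma jacobi_ultra_L_high:
  assumes "\<xi> > 0" "\<beta> = real \<epsilon> - 1/2" "\<epsilon> \<le> 1"
  shows "ultra_L_high \<alpha> (\<lambda>s. s ^ \<epsilon> * poly f (2 * s\<^sup>2 - 1)) \<xi> =
    4 ^ (\<alpha> + 2) * \<xi> ^ \<epsilon> * jacobi_L_high \<alpha> \<beta> (poly f) (2 * \<xi>\<^sup>2 - 1)"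
proof -
  let ?m = "\<alpha> + 2"
  have x: "2 * \<xi>\<^sup>2 - 1 > - 1" using assms(1) by simp
  have "2 ^ k / 2 ^ (\<alpha> + 1) * pochhammer (real (2 * k + \<epsilon>) - real (2 * \<alpha> + 4) + 1) (2 * \<alpha> + 4) *
       \<xi> powr (real (2 * k + \<epsilon>) - real (2 * \<alpha> + 4)) =
     2 * (4 ^ ?m * \<xi> ^ \<epsilon> * (pochhammer (real k - real ?m + 1) ?m *
       pochhammer (real k + \<beta> - real ?m + 1) ?m *
       (2 * \<xi>\<^sup>2 - 1 + 1) powr (real k - real ?m)))" (is "?l k = 2 * (_ * ?r k)") for k
  proof -
    have poch: "pochhammer (real (2 * k + \<epsilon>) - real (2 * \<alpha> + 4) + 1) (2 * \<alpha> + 4) =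
        4 ^ ?m * (pochhammer (real k - real ?m + 1) ?m *
          pochhammer (real k + \<beta> - real ?m + 1) ?m)"
    proof -
      have "real (2 * k + \<epsilon>) - real (2 * \<alpha> + 4) + 1 = 2 * (real k - real ?m + 1) + real \<epsilon> - 1"
        "2 * \<alpha> + 4 = 2 * ?m" "real k + \<beta> - real ?m + 1 = real k - real ?m + 1 + \<beta>"
        by simp_all
      then show ?thesis by (simp only: pochhammer_split_parity[OF assms(2,3)])
    qed
    have powr: "2 ^ k / 2 ^ (\<alpha> + 1) * \<xi> powr (real (2 * k + \<epsilon>) - real (2 * \<alpha> + 4)) =
        2 * (\<xi> ^ \<epsilon> * (2 * \<xi>\<^sup>2 - 1 + 1) powr (real k - real ?m))"
    proof -
      have "(2 * \<xi>\<^sup>2) powr (real k - real ?m) = 2 ^ k / 2 ^ ?m * (\<xi>\<^sup>2) powr (real k - real ?m)"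
        by (simp add: powr_mult powr_diff powr_realpow[symmetric] del: power_Suc of_nat_add add_2_eq_Suc add_2_eq_Suc')
      also have "(\<xi>\<^sup>2) powr (real k - real ?m) = \<xi> powr (2 * (real k - real ?m))"
        using assms(1) powr_powr[of \<xi> 2 "real k - real ?m"] by (simp add: powr_numeral)
      finally have *: "(2 * \<xi>\<^sup>2) powr (real k - real ?m) =
         2 ^ k / 2 ^ ?m * \<xi> powr (2 * (real k - real ?m))" .
      have "\<xi> powr (real (2 * k + \<epsilon>) - real (2 * \<alpha> + 4)) =
          \<xi> powr (real \<epsilon> + 2 * (real k - real ?m))"
        by (simp add: algebra_simps)
      also have "\<dots> = \<xi> ^ \<epsilon> * \<xi> powr (2 * (real k - real ?m))"
        using assms(1) by (simp only: powr_add powr_realpow)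
      finally show ?thesis using * by simp
    qed
    have "2 ^ k / 2 ^ (\<alpha> + 1) * pochhammer (real (2 * k + \<epsilon>) - real (2 * \<alpha> + 4) + 1) (2 * \<alpha> + 4) *
         \<xi> powr (real (2 * k + \<epsilon>) - real (2 * \<alpha> + 4)) =
       pochhammer (real (2 * k + \<epsilon>) - real (2 * \<alpha> + 4) + 1) (2 * \<alpha> + 4) *
         (2 ^ k / 2 ^ (\<alpha> + 1) * \<xi> powr (real (2 * k + \<epsilon>) - real (2 * \<alpha> + 4)))"
      by (simp only: mult_ac)
    then show ?thesis unfolding poch powr by (simp only: mult_ac)
  qed
  then have "(\<Sum>k\<le>shifted_degree \<alpha> f. shifted_coeff \<alpha> f k * ?l k) =
      2 * (4 ^ ?m * \<xi> ^ \<epsilon> * (\<Sum>k\<le>shifted_degree \<alpha> f. shifted_coeff \<alpha> f k * ?r k))"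
    unfolding sum_distrib_left by (intro sum.cong refl) (simp only: mult_ac)
  then show ?thesis
    unfolding ultra_L_high_poly[OF assms(1)] jacobi_L_high_poly[OF x]
    by (simp only: mult.assoc times_divide_eq_right times_divide_eq_left)
      (simp add: algebra_simps del: pochhammer_Suc power_Suc)
qed

section \<open>Comparison of the differential equations\<close>

lemma deriv_poly: "deriv (poly f) = poly (pderiv f)"
  by (auto intro!: DERIV_imp_deriv poly_DERIV)

text \<open>
  The extra multiple of the function in the odd case comes from \<open>2(\<alpha>+1)\<xi> D\<^sub>\<xi>\<close> acting on the factor
  \<open>\<xi>\<close>. It equals the amount by which \<open>(2n+1)(2n+2\<alpha>+2)\<close> exceeds \<open>4n(n+\<alpha>+3/2)\<close>, so it disappears
  once the eigenvalues are subtracted.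
\<close>

lemma jacobi_ultra_L2:
  assumes "\<beta> = real \<epsilon> - 1/2" "\<epsilon> \<le> 1"
  shows "ultra_L2 \<alpha> (\<lambda>s. s ^ \<epsilon> * poly f (2 * s\<^sup>2 - 1)) \<xi> =
    4 * \<xi> ^ \<epsilon> * jacobi_L2 \<alpha> \<beta> (poly f) (2 * \<xi>\<^sup>2 - 1) +
    2 * real \<epsilon> * (real \<alpha> + 1) * (\<xi> ^ \<epsilon> * poly f (2 * \<xi>\<^sup>2 - 1))"
proof -
  have u: "(\<lambda>s. s ^ \<epsilon> * poly f (2 * s\<^sup>2 - 1)) = poly ([:0, 1:] ^ \<epsilon> * pcompose f [:-1, 0, 2:])"
    by (simp add: fun_eq_iff poly_pcompose power2_eq_square poly_power algebra_simps)
  have \<epsilon>: "\<epsilon> = 0 \<or> \<epsilon> = 1" using assms(2) by linarith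
  have funpow2: "(deriv ^^ 2) g = deriv (deriv g)" for g :: "real \<Rightarrow> real"
    by (simp add: numeral_2_eq_2)
  show ?thesis
    unfolding ultra_L2_def jacobi_L2_def u funpow2 deriv_poly assms(1)
    using \<epsilon>
    by (auto simp: pderiv_pcompose pderiv_mult pderiv_add pderiv_pCons poly_pcompose pderiv_smult
        algebra_simps power2_eq_square)
qed

text \<open>
  The factor \<open>2\<alpha> + 3\<close> in the odd case is \<open>(3/2)\<^sub>\<alpha>\<^sub>+\<^sub>1 / (1/2)\<^sub>\<alpha>\<^sub>+\<^sub>1\<close>; the
  same factor distinguishes the mass \<open>(4\<alpha>+6)N\<close> of the odd case from the mass \<open>2N\<close> of the even one.
\<close>

lemma jacobi_C_half:
  assumes "\<beta> = real \<epsilon> - 1/2" "\<epsilon> \<le> 1"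
  shows "4 ^ (\<alpha> + 1) * jacobi_C \<alpha> \<beta> = 2 * (2 * real \<alpha> + 3) ^ \<epsilon> * ultra_C \<alpha>"
proof -
  have "pochhammer (1 :: real) (2 * (\<alpha> + 1)) =
     4 ^ (\<alpha> + 1) * (pochhammer 1 (\<alpha> + 1) * pochhammer (1/2) (\<alpha> + 1))"
    \<comment> \<open>The instance \<open>\<epsilon> = 0\<close>, \<open>z = 1\<close> starts the product at \<open>2z - 1 = 1\<close>.\<close>
    using pochhammer_split_parity[of "-1/2" 0 1 "\<alpha> + 1"] by simp
  then have fact: "fact (2 * \<alpha> + 2) = 4 ^ (\<alpha> + 1) * fact (\<alpha> + 1) * pochhammer (1/2 :: real) (\<alpha> + 1)"
    by (simp add: pochhammer_fact del: pochhammer_Suc)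
  have "pochhammer (\<beta> + 1) (\<alpha> + 1) = (2 * real \<alpha> + 3) ^ \<epsilon> * pochhammer (1/2) (\<alpha> + 1)"
  proof -
    consider "\<epsilon> = 0" | "\<epsilon> = 1" using assms(2) by linarith
    then show ?thesis
    proof cases
      case 2
      have "pochhammer (1/2 :: real) (Suc (\<alpha> + 1)) = 1/2 * pochhammer (3/2) (\<alpha> + 1)"
        by (subst pochhammer_rec) simp
      moreover have "pochhammer (1/2 :: real) (Suc (\<alpha> + 1)) =
          pochhammer (1/2) (\<alpha> + 1) * (1/2 + real (\<alpha> + 1))"
        by (rule pochhammer_Suc)
      ultimately have "pochhammer (3/2) (\<alpha> + 1) = (2 * real \<alpha> + 3) * pochhammer (1/2 :: real) (\<alpha> + 1)"
        by (simp add: algebra_simps del: pochhammer_Suc)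
      moreover have \<beta>: "\<beta> + 1 = 3/2" using 2 assms(1) by simp
      ultimately show ?thesis unfolding 2 \<beta> by simp
    qed (simp add: assms(1))
  qed
  moreover have "fact (\<alpha> + 2) = (real \<alpha> + 2) * fact (\<alpha> + 1)"
    by (simp add: algebra_simps)
  ultimately show ?thesis
    unfolding jacobi_C_def ultra_C_def fact by (simp del: pochhammer_Suc power_Suc fact_Suc)
qed

lemma jacobi_type_lhs_eq_ultra_type_lhs:
  assumes "\<xi> > 0" "\<beta> = real \<epsilon> - 1/2" "\<epsilon> \<le> 1"
    and K: "K = 2 * (2 * real \<alpha> + 3) ^ \<epsilon> * N"
  shows "jacobi_type_lhs \<alpha> \<beta> K n (poly f) (2 * \<xi>\<^sup>2 - 1) =
    2 * (2 * real \<alpha> + 3) ^ \<epsilon> / (4 ^ (\<alpha> + 2) * \<xi> ^ \<epsilon>) *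
    ultra_type_lhs \<alpha> N (2 * n + \<epsilon>) (\<lambda>s. s ^ \<epsilon> * poly f (2 * s\<^sup>2 - 1)) \<xi>"
proof -
  let ?F = "(4 :: real) ^ (\<alpha> + 2)" and ?e = "\<xi> ^ \<epsilon>" and ?k = "(2 * real \<alpha> + 3) ^ \<epsilon>"
  let ?x = "2 * \<xi>\<^sup>2 - 1"
  have Lam: "ultra_Lambda_high \<alpha> (2 * n + \<epsilon>) = ?F * jacobi_Lambda_high \<alpha> \<beta> n"
  proof -
    have "real (2 * n + \<epsilon>) - 1 = 2 * real n + real \<epsilon> - 1" "2 * \<alpha> + 4 = 2 * (\<alpha> + 2)" by simp_all
    then show ?thesis
      unfolding ultra_Lambda_high_def jacobi_Lambda_high_def
      by (simp only: pochhammer_split_parity[OF assms(2,3)])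
  qed
  have Lam2: "ultra_Lambda2 \<alpha> (2 * n + \<epsilon>) =
      4 * jacobi_Lambda2 \<alpha> \<beta> n + 2 * real \<epsilon> * (real \<alpha> + 1)"
  proof -
    consider "\<epsilon> = 0" | "\<epsilon> = 1" using assms(3) by linarith
    then show ?thesis
      by cases (simp_all add: ultra_Lambda2_def jacobi_Lambda2_def assms(2) algebra_simps)
  qed
  have C: "?F * jacobi_C \<alpha> \<beta> = 8 * ?k * ultra_C \<alpha>"
    using jacobi_C_half[OF assms(2,3), of \<alpha>] by simp
  have "ultra_type_lhs \<alpha> N (2 * n + \<epsilon>) (\<lambda>s. s ^ \<epsilon> * poly f (2 * s\<^sup>2 - 1)) \<xi> =
      ?e * (N * ?F * (jacobi_L_high \<alpha> \<beta> (poly f) ?x - jacobi_Lambda_high \<alpha> \<beta> n * poly f ?x) +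
        4 * ultra_C \<alpha> * (jacobi_L2 \<alpha> \<beta> (poly f) ?x - jacobi_Lambda2 \<alpha> \<beta> n * poly f ?x))"
    unfolding ultra_type_lhs_def jacobi_ultra_L_high[OF assms(1-3)] jacobi_ultra_L2[OF assms(2,3)] Lam Lam2
    by (simp only: ring_distribs mult_ac right_diff_distrib left_diff_distrib)
  then have "2 * ?k * ultra_type_lhs \<alpha> N (2 * n + \<epsilon>) (\<lambda>s. s ^ \<epsilon> * poly f (2 * s\<^sup>2 - 1)) \<xi> =
      ?e * (?F * (2 * ?k * N) * (jacobi_L_high \<alpha> \<beta> (poly f) ?x - jacobi_Lambda_high \<alpha> \<beta> n * poly f ?x) +
        8 * ?k * ultra_C \<alpha> * (jacobi_L2 \<alpha> \<beta> (poly f) ?x - jacobi_Lambda2 \<alpha> \<beta> n * poly f ?x))"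
    by (simp only: ring_distribs mult_ac)
  also have "\<dots> = ?F * ?e * jacobi_type_lhs \<alpha> \<beta> K n (poly f) ?x"
    unfolding K C[symmetric] jacobi_type_lhs_def by (simp only: ring_distribs mult_ac)
  finally show ?thesis using assms(1) by (simp add: field_simps del: power_Suc)
qed

section \<open>Jacobi-type polynomials in the variable \<open>t = (1 - x)/2\<close>\<close>

text \<open>
  The hypergeometric sum as a polynomial in \<open>t\<close>, with \<open>(-n)\<^sub>j / j!\<close> written as \<open>(-1)^j (n choose j)\<close>
  so that sums over the coefficients are finite differences.
\<close>

definition jacobi_poly :: "real \<Rightarrow> real \<Rightarrow> nat \<Rightarrow> real poly" where
  "jacobi_poly a \<beta> n = (\<Sum>j\<le>n. monom (pochhammer (a + 1) n / fact n *
     ((- 1) ^ j * real (n choose j) * pochhammer (real n + a + \<beta> + 1) j / pochhammer (a + 1) j)) j)"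

lemma coeff_jacobi_poly:
  "j \<le> n \<Longrightarrow> coeff (jacobi_poly a \<beta> n) j = pochhammer (a + 1) n / fact n *
     ((- 1) ^ j * real (n choose j) * pochhammer (real n + a + \<beta> + 1) j / pochhammer (a + 1) j)"
  by (simp add: jacobi_poly_def coeff_sum)

lemma degree_jacobi_poly: "degree (jacobi_poly a \<beta> n) \<le> n"
  unfolding jacobi_poly_def
  by (rule degree_sum_le) (auto intro: order.trans[OF degree_monom_le])

lemma jacobi_P_eq_poly: "jacobi_P \<alpha> \<beta> n x = poly (jacobi_poly (real \<alpha>) \<beta> n) ((1 - x) / 2)"
proof -
  let ?t = "(1 - x) / 2"
  let ?f = "fps_hypergeo [- real n, real n + real \<alpha> + \<beta> + 1] [real \<alpha> + 1] 1"
  have coeff: "fps_nth ?f j = (- 1) ^ j * real (n choose j) *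
      pochhammer (real n + real \<alpha> + \<beta> + 1) j / pochhammer (real \<alpha> + 1) j" for j
  proof -
    have "real (n choose j) = (- 1) ^ j * pochhammer (- real n) j / fact j"
      by (simp add: binomial_gbinomial gbinomial_pochhammer)
    then have "(- 1) ^ j * real (n choose j) = pochhammer (- real n) j / fact j"
      by (simp add: mult.assoc[symmetric] power_mult_distrib[symmetric])
    then show ?thesis by (simp add: fps_hypergeo_def mult.commute)
  qed
  have "hyp2F1 (- real n) (real n + real \<alpha> + \<beta> + 1) (real \<alpha> + 1) ?t = (\<Sum>j\<le>n. fps_nth ?f j * ?t ^ j)"
    unfolding hyp2F1_def eval_fps_def by (rule suminf_finite) (auto simp: pochhammer_of_nat_eq_0_iff)
  then show ?thesis
    unfolding jacobi_P_def jacobi_poly_def coeff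
    by (simp add: poly_sum poly_monom sum_distrib_left mult.assoc)
qed

text \<open>
  The factor \<open>x - 1\<close> of \<open>R\<^sub>n\<close> becomes \<open>-2t\<close>, whence the sign and the shift of the coefficients.
\<close>

definition jacobi_type_poly :: "nat \<Rightarrow> real \<Rightarrow> real \<Rightarrow> nat \<Rightarrow> real poly" where
  "jacobi_type_poly \<alpha> \<beta> K n = jacobi_poly (real \<alpha>) \<beta> n -
     (if n = 0 then 0
      else smult (2 * K * jacobi_A \<alpha> \<beta> n) (pCons 0 (jacobi_poly (real \<alpha> + 2) \<beta> (n - 1))))"

lemma jacobi_type_P_eq_poly:
  "jacobi_type_P \<alpha> \<beta> K n x = poly (jacobi_type_poly \<alpha> \<beta> K n) ((1 - x) / 2)"
  by (simp add: jacobi_type_P_def jacobi_R_def jacobi_type_poly_def jacobi_P_eq_poly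
      algebra_simps diff_divide_distrib)

lemma degree_jacobi_type_poly: "degree (jacobi_type_poly \<alpha> \<beta> K n) \<le> n"
proof (cases n)
  case 0
  then show ?thesis
    using degree_jacobi_poly[of "real \<alpha>" \<beta> 0] by (simp add: jacobi_type_poly_def)
next
  case (Suc m)
  let ?G = "pCons 0 (jacobi_poly (real \<alpha> + 2) \<beta> m)"
  have "degree ?G \<le> n"
    using degree_pCons_le[of 0 "jacobi_poly (real \<alpha> + 2) \<beta> m"]
      degree_jacobi_poly[of "real \<alpha> + 2" \<beta> m] Suc by linarith
  then have "degree (smult (2 * K * jacobi_A \<alpha> \<beta> n) ?G) \<le> n"
    by (rule order.trans[OF degree_smult_le])
  then show ?thesis
    unfolding jacobi_type_poly_def using Suc
    by (auto intro!: degree_diff_le degree_jacobi_poly simp del: smult_pCons)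
qed

lemma coeff_0_jacobi_type_poly:
  "coeff (jacobi_type_poly \<alpha> \<beta> K n) 0 = pochhammer (real \<alpha> + 1) n / fact n"
  by (simp add: jacobi_type_poly_def coeff_jacobi_poly)

section \<open>Finite differences of polynomials and of simple fractions\<close>

lemma alternating_binomial_sum_Suc:
  fixes g :: "nat \<Rightarrow> real"
  shows "(\<Sum>j\<le>Suc n. (- 1) ^ j * real (Suc n choose j) * g j) =
    (\<Sum>j\<le>n. (- 1) ^ j * real (n choose j) * (g j - g (Suc j)))"
proof -
  have "(\<Sum>j\<le>Suc n. (- 1) ^ j * real (Suc n choose j) * g j) =
      g 0 + (\<Sum>j\<le>n. (- 1) ^ Suc j * real (n choose Suc j) * g (Suc j)) -
      (\<Sum>j\<le>n. (- 1) ^ j * real (n choose j) * g (Suc j))"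
    by (subst sum.atMost_Suc_shift)
      (simp add: algebra_simps sum.distrib sum_subtractf sum_negf)
  also have "g 0 + (\<Sum>j\<le>n. (- 1) ^ Suc j * real (n choose Suc j) * g (Suc j)) =
      (\<Sum>j\<le>Suc n. (- 1) ^ j * real (n choose j) * g j)"
    by (subst sum.atMost_Suc_shift) simp
  also have "\<dots> = (\<Sum>j\<le>n. (- 1) ^ j * real (n choose j) * g j)"
    by simp
  finally show ?thesis by (simp add: algebra_simps sum_subtractf)
qed

text \<open>
  Passing from \<open>p(x)\<close> to \<open>p(x) - p(x+1)\<close> cancels the leading term.
\<close>

lemma alternating_binomial_sum_poly:
  fixes p :: "real poly"
  assumes "degree p < n"
  shows "(\<Sum>j\<le>n. (- 1) ^ j * real (n choose j) * poly p (real j)) = 0"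
  using assms
proof (induction n arbitrary: p)
  case (Suc n)
  let ?q = "p - pcompose p [:1, 1:]"
  have sum: "(\<Sum>j\<le>Suc n. (- 1) ^ j * real (Suc n choose j) * poly p (real j)) =
      (\<Sum>j\<le>n. (- 1) ^ j * real (n choose j) * poly ?q (real j))"
    by (subst alternating_binomial_sum_Suc) (simp add: poly_pcompose)
  have le: "degree ?q \<le> degree p"
    by (rule degree_diff_le) (auto simp: degree_pcompose)
  have lead: "coeff ?q (degree p) = 0"
    using lead_coeff_comp[of "[:1, 1:]" p] by (simp add: degree_pcompose)
  show ?case
  proof (cases "degree ?q < n")
    case True
    show ?thesis by (simp only: sum Suc.IH[OF True])
  next
    case False
    then have "degree ?q = degree p" using le Suc.prems by linarith
    \<comment> \<open>Then \<open>p\<close> is constant, so the difference vanishes identically.\<close>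
    then have "?q = 0" using lead by (metis leading_coeff_0_iff)
    then show ?thesis using sum by simp
  qed
qed simp

lemma alternating_binomial_sum_inverse:
  fixes a :: real
  assumes "a > 0"
  shows "(\<Sum>j\<le>n. (- 1) ^ j * real (n choose j) * (1 / (real j + a))) = fact n / pochhammer a (Suc n)"
  using assms
proof (induction n arbitrary: a)
  case (Suc n)
  have "(\<Sum>j\<le>Suc n. (- 1) ^ j * real (Suc n choose j) * (1 / (real j + a))) =
     (\<Sum>j\<le>n. (- 1) ^ j * real (n choose j) * (1 / (real j + a))) -
     (\<Sum>j\<le>n. (- 1) ^ j * real (n choose j) * (1 / (real j + (a + 1))))"
    by (subst alternating_binomial_sum_Suc) (simp add: algebra_simps sum_subtractf)
  also have "\<dots> = fact n / pochhammer a (Suc n) - fact n / pochhammer (a + 1) (Suc n)"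
    using Suc.IH[of a] Suc.IH[of "a + 1"] Suc.prems by simp
  also have "\<dots> = fact (Suc n) / pochhammer a (Suc (Suc n))"
  proof -
    define w where "w = pochhammer (a + 1) n"
    have w: "w > 0" using Suc.prems by (simp add: w_def pochhammer_pos)
    have "pochhammer a (Suc n) = a * w" by (simp add: w_def pochhammer_rec)
    moreover have "pochhammer (a + 1) (Suc n) = w * (a + 1 + real n)"
      by (simp add: w_def pochhammer_Suc)
    moreover have "pochhammer a (Suc (Suc n)) = a * w * (a + 1 + real n)"
      using calculation by (simp add: pochhammer_Suc algebra_simps)
    ultimately show ?thesis
      using w Suc.prems by (simp add: divide_simps) (simp add: algebra_simps)
  qed
  finally show ?case .
qed simp

text \<open>
  Dividing \<open>p\<close> by \<open>x + a\<close> leaves a polynomial of degree below \<open>n\<close>, killed by the \<open>n\<close>-th difference,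
  and the remainder \<open>p(-a)\<close> over \<open>x + a\<close>.
\<close>

lemma alternating_binomial_sum_partial_fraction:
  fixes p :: "real poly"
  assumes "degree p \<le> n" "a > 0"
  shows "(\<Sum>j\<le>n. (- 1) ^ j * real (n choose j) * (poly p (real j) / (real j + a))) =
    poly p (- a) * fact n / pochhammer a (Suc n)"
proof -
  obtain q where q: "p - [:poly p (- a):] = [:a, 1:] * q"
    using poly_eq_0_iff_dvd[of "p - [:poly p (- a):]" "- a"] by (auto elim: dvdE)
  have p: "poly p (real j) = (real j + a) * poly q (real j) + poly p (- a)" for j
    using arg_cong[OF q, of "\<lambda>r. poly r (real j)"] by (simp add: algebra_simps)
  have split: "poly p (real j) / (real j + a) = poly q (real j) + poly p (- a) * (1 / (real j + a))" for j
    using assms(2) unfolding p by (simp add: field_simps)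
  have "(\<Sum>j\<le>n. (- 1) ^ j * real (n choose j) * poly q (real j)) = 0"
  proof (cases "q = 0")
    case False
    have "degree ([:a, 1:] * q) \<le> n"
      unfolding q[symmetric] by (rule degree_diff_le) (use assms(1) in auto)
    moreover have "degree ([:a, 1:] * q) = 1 + degree q"
      using False by (subst degree_mult_eq) auto
    ultimately have "degree q < n" by linarith
    then show ?thesis by (rule alternating_binomial_sum_poly)
  qed simp
  moreover have "(\<Sum>j\<le>n. (- 1) ^ j * real (n choose j) * (poly p (real j) / (real j + a))) =
      (\<Sum>j\<le>n. (- 1) ^ j * real (n choose j) * poly q (real j)) +
      poly p (- a) * (\<Sum>j\<le>n. (- 1) ^ j * real (n choose j) * (1 / (real j + a)))"
    unfolding split sum_distrib_left sum.distrib[symmetric]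
    by (intro sum.cong refl) (simp add: algebra_simps)
  ultimately show ?thesis
    using alternating_binomial_sum_inverse[OF assms(2), of n] by simp
qed

section \<open>Orthogonality with respect to the beta moments\<close>

text \<open>
  The integral of \<open>t^j (1 - t)^k\<close> against the density of the beta distribution with parameters
  \<open>a + 1\<close> and \<open>\<beta> + 1\<close>, that is, against the Jacobi weight normalized to total mass one.
\<close>

definition beta_moment :: "real \<Rightarrow> real \<Rightarrow> nat \<Rightarrow> nat \<Rightarrow> real" where
  "beta_moment a \<beta> j k =
     pochhammer (a + 1) j * pochhammer (\<beta> + 1) k / pochhammer (a + \<beta> + 2) (j + k)"

lemma poly_pochhammer: "poly (pochhammer [:c, 1:] m) x = pochhammer (c + x :: real) m"
  by (induction m) (simp_all add: pochhammer_Suc of_nat_poly algebra_simps)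

lemma degree_pochhammer_poly: "degree (pochhammer [:c :: real, 1:] m) \<le> m"
proof (induction m)
  case (Suc m)
  have "degree ([:c, 1:] + of_nat m) \<le> 1" by (simp add: of_nat_poly)
  then show ?case
    unfolding pochhammer_Suc
    using degree_mult_le[of "pochhammer [:c, 1:] m" "[:c, 1:] + of_nat m"] Suc by linarith
qed simp

text \<open>
  For fixed \<open>i \<le> l\<close> the quotient is a polynomial in \<open>j\<close> of degree \<open>l - i\<close>. This is why the sums
  over hypergeometric coefficients below are finite differences of polynomials.
\<close>

lemma pochhammer_quotient:
  fixes s :: real
  assumes "s > 0" "i \<le> l"
  shows "pochhammer (s + real l) j / pochhammer s (j + i) =
    pochhammer (s + real i + real j) (l - i) / pochhammer s l"
proof -
  have "pochhammer s l * pochhammer (s + real l) j =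
      pochhammer s (j + i) * pochhammer (s + real i + real j) (l - i)"
    using pochhammer_product'[of s l j] pochhammer_product'[of s "j + i" "l - i"] assms(2)
    by (simp add: algebra_simps)
  moreover have "pochhammer s l > 0" "pochhammer s (j + i) > 0"
    using assms(1) by (simp_all add: pochhammer_pos)
  ultimately show ?thesis by (simp add: field_simps)
qed

lemma jacobi_poly_orthogonal:
  assumes "a > - 1" "\<beta> > - 1" "k < n"
  shows "(\<Sum>j\<le>n. coeff (jacobi_poly a \<beta> n) j * beta_moment a \<beta> j k) = 0"
proof -
  let ?s = "a + \<beta> + 2" and ?p = "pochhammer [:a + \<beta> + 2 + real k, 1:] (n - 1 - k)"
  have "coeff (jacobi_poly a \<beta> n) j * beta_moment a \<beta> j k =
      pochhammer (a + 1) n / fact n * pochhammer (\<beta> + 1) k / pochhammer ?s (n - 1) *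
      ((- 1) ^ j * real (n choose j) * poly ?p (real j))" if "j \<le> n" for j
  proof -
    have "pochhammer (a + 1) j > 0" using assms(1) by (intro pochhammer_pos) simp
    moreover have "pochhammer (real n + a + \<beta> + 1) j / pochhammer ?s (j + k) =
        poly ?p (real j) / pochhammer ?s (n - 1)"
      using pochhammer_quotient[of ?s k "n - 1" j] assms
      by (simp add: poly_pochhammer of_nat_diff algebra_simps)
    moreover have "coeff (jacobi_poly a \<beta> n) j * beta_moment a \<beta> j k =
        pochhammer (a + 1) n / fact n * ((- 1) ^ j * real (n choose j)) * pochhammer (\<beta> + 1) k *
        (pochhammer (a + 1) j / pochhammer (a + 1) j) *
        (pochhammer (real n + a + \<beta> + 1) j / pochhammer ?s (j + k))"
      unfolding coeff_jacobi_poly[OF that] beta_moment_def by (simp add: mult_ac)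
    ultimately show ?thesis by (simp add: mult_ac)
  qed
  then have "(\<Sum>j\<le>n. coeff (jacobi_poly a \<beta> n) j * beta_moment a \<beta> j k) =
      pochhammer (a + 1) n / fact n * pochhammer (\<beta> + 1) k / pochhammer ?s (n - 1) *
      (\<Sum>j\<le>n. (- 1) ^ j * real (n choose j) * poly ?p (real j))"
    unfolding sum_distrib_left by (intro sum.cong) auto
  moreover have "degree ?p < n"
    using degree_pochhammer_poly[of "a + \<beta> + 2 + real k" "n - 1 - k"] assms(3) by linarith
  ultimately show ?thesis by (simp add: alternating_binomial_sum_poly)
qed

text \<open>
  The moment is taken with parameter \<open>a\<close> while the polynomial belongs to \<open>a + 2\<close>, so one factor
  \<open>1 / (j + a + 2)\<close> survives, and the partial fraction formula applies. The value at \<open>-(a+2)\<close>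
  of the remaining polynomial completes \<open>(\<beta>+1)\<^sub>k\<close> to \<open>(\<beta>+1)\<^sub>n\<close>, which removes the
  dependence on \<open>k\<close>.
\<close>

lemma jacobi_poly_shifted_moment:
  assumes "a > - 1" "\<beta> > - 1" "k \<le> n"
  shows "(\<Sum>j\<le>n. coeff (jacobi_poly (a + 2) \<beta> n) j * beta_moment a \<beta> (Suc j) k) =
    (a + 1) * pochhammer (\<beta> + 1) n / pochhammer (a + \<beta> + 2) (Suc n)"
proof -
  let ?s = "a + \<beta> + 2" and ?p = "pochhammer [:a + \<beta> + 3 + real k, 1:] (n - k)"
  let ?D = "pochhammer (a + 3) n / fact n * (a + 1) * (a + 2) * pochhammer (\<beta> + 1) k /
      pochhammer ?s (Suc n)"
  have pos: "pochhammer (a + 3) j > 0" for j using assms(1) by (intro pochhammer_pos) simp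
  have "coeff (jacobi_poly (a + 2) \<beta> n) j * beta_moment a \<beta> (Suc j) k =
      ?D * ((- 1) ^ j * real (n choose j) * (poly ?p (real j) / (real j + (a + 2))))" if "j \<le> n" for j
  proof -
    have quot: "pochhammer (real n + a + \<beta> + 3) j / pochhammer ?s (Suc j + k) =
        poly ?p (real j) / pochhammer ?s (Suc n)"
      using pochhammer_quotient[of ?s "Suc k" "Suc n" j] assms
      by (simp add: poly_pochhammer algebra_simps del: pochhammer_Suc)
    have "pochhammer (a + 1) (Suc (Suc j)) = (a + 1) * (a + 2) * pochhammer (a + 3) j"
      by (simp add: pochhammer_rec algebra_simps del: pochhammer_Suc)
    then have "pochhammer (a + 1) (Suc j) * (real j + (a + 2)) = (a + 1) * (a + 2) * pochhammer (a + 3) j"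
      by (subst (asm) pochhammer_Suc) (simp add: algebra_simps del: pochhammer_Suc)
    then have ratio: "pochhammer (a + 1) (Suc j) / pochhammer (a + 3) j =
        (a + 1) * (a + 2) / (real j + (a + 2))"
      using pos[of j] assms(1) by (simp add: field_simps del: pochhammer_Suc)
    have "coeff (jacobi_poly (a + 2) \<beta> n) j * beta_moment a \<beta> (Suc j) k =
        pochhammer (a + 3) n / fact n * ((- 1) ^ j * real (n choose j)) * pochhammer (\<beta> + 1) k *
        (pochhammer (a + 1) (Suc j) / pochhammer (a + 3) j) *
        (pochhammer (real n + a + \<beta> + 3) j / pochhammer ?s (Suc j + k))"
      unfolding coeff_jacobi_poly[OF that] beta_moment_def
      by (simp add: algebra_simps del: pochhammer_Suc)
    then show ?thesis
      unfolding quot ratio by (simp add: mult_ac)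
  qed
  then have "(\<Sum>j\<le>n. coeff (jacobi_poly (a + 2) \<beta> n) j * beta_moment a \<beta> (Suc j) k) =
      ?D * (\<Sum>j\<le>n. (- 1) ^ j * real (n choose j) * (poly ?p (real j) / (real j + (a + 2))))"
    unfolding sum_distrib_left by (intro sum.cong) auto
  also have "(\<Sum>j\<le>n. (- 1) ^ j * real (n choose j) * (poly ?p (real j) / (real j + (a + 2)))) =
      poly ?p (- (a + 2)) * fact n / pochhammer (a + 2) (Suc n)"
    using degree_pochhammer_poly[of "a + \<beta> + 3 + real k" "n - k"] assms(1)
    by (intro alternating_binomial_sum_partial_fraction) auto
  also have "poly ?p (- (a + 2)) = pochhammer (\<beta> + 1 + real k) (n - k)"
    by (simp add: poly_pochhammer algebra_simps)
  also have "pochhammer (a + 2) (Suc n) = (a + 2) * pochhammer (a + 3) n"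
    by (simp add: pochhammer_rec algebra_simps del: pochhammer_Suc)
  also have "?D * (pochhammer (\<beta> + 1 + real k) (n - k) * fact n / ((a + 2) * pochhammer (a + 3) n)) =
      (a + 1) * (pochhammer (\<beta> + 1) k * pochhammer (\<beta> + 1 + real k) (n - k)) / pochhammer ?s (Suc n)"
    using pos[of n] assms(1) by (simp add: divide_simps del: pochhammer_Suc)
  also have "pochhammer (\<beta> + 1) k * pochhammer (\<beta> + 1 + real k) (n - k) = pochhammer (\<beta> + 1) n"
    using assms(3) by (rule pochhammer_product[symmetric])
  finally show ?thesis .
qed

text \<open>
  The left-hand side is the inner product with \<open>(1 - t)^k\<close> for the beta density and a mass \<open>K\<close> at
  \<open>t = 0\<close>. The mass contributes the same for every \<open>k\<close>, and the constant \<open>A\<^sub>n\<close> in the definition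
  of \<open>R\<^sub>n\<close> is exactly what makes the two contributions cancel.
\<close>

lemma jacobi_type_poly_orthogonal:
  assumes "\<beta> > - 1" "k < n"
  shows "(\<Sum>j\<le>n. coeff (jacobi_type_poly \<alpha> \<beta> K n) j * beta_moment (real \<alpha>) \<beta> j k) +
    K * coeff (jacobi_type_poly \<alpha> \<beta> K n) 0 = 0"
proof -
  obtain m where n: "n = Suc m" using assms(2) by (cases n) auto
  let ?G = "jacobi_poly (real \<alpha> + 2) \<beta> m"
  have "(\<Sum>j\<le>n. coeff (pCons 0 ?G) j * beta_moment (real \<alpha>) \<beta> j k) =
      (\<Sum>j\<le>m. coeff ?G j * beta_moment (real \<alpha>) \<beta> (Suc j) k)"
    unfolding n by (subst sum.atMost_Suc_shift) simp
  also have "\<dots> = (real \<alpha> + 1) * pochhammer (\<beta> + 1) m / pochhammer (real \<alpha> + \<beta> + 2) n"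
    using jacobi_poly_shifted_moment[of "real \<alpha>" \<beta> k m] assms n by simp
  finally have kernel: "(\<Sum>j\<le>n. coeff (pCons 0 ?G) j * beta_moment (real \<alpha>) \<beta> j k) = \<dots>" .
  have pos: "pochhammer (\<beta> + 1) m > 0" "pochhammer (real \<alpha> + \<beta> + 2) n > 0"
    using assms(1) by (auto intro!: pochhammer_pos)
  have "2 * jacobi_A \<alpha> \<beta> n * (\<Sum>j\<le>n. coeff (pCons 0 ?G) j * beta_moment (real \<alpha>) \<beta> j k) =
      (real \<alpha> + 1) * pochhammer (real \<alpha> + 2) m / fact n"
    unfolding kernel jacobi_A_def using pos n by (simp add: field_simps del: pochhammer_Suc fact_Suc)
  also have "(real \<alpha> + 1) * pochhammer (real \<alpha> + 2) m = pochhammer (real \<alpha> + 1) n"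
    unfolding n by (simp add: pochhammer_rec algebra_simps del: pochhammer_Suc)
  finally have mass: "2 * jacobi_A \<alpha> \<beta> n * (\<Sum>j\<le>n. coeff (pCons 0 ?G) j * beta_moment (real \<alpha>) \<beta> j k) =
      coeff (jacobi_type_poly \<alpha> \<beta> K n) 0"
    by (simp add: coeff_0_jacobi_type_poly)
  have "(\<Sum>j\<le>n. coeff (jacobi_type_poly \<alpha> \<beta> K n) j * beta_moment (real \<alpha>) \<beta> j k) =
      (\<Sum>j\<le>n. coeff (jacobi_poly (real \<alpha>) \<beta> n) j * beta_moment (real \<alpha>) \<beta> j k) -
      K * (2 * jacobi_A \<alpha> \<beta> n * (\<Sum>j\<le>n. coeff (pCons 0 ?G) j * beta_moment (real \<alpha>) \<beta> j k))"
    unfolding jacobi_type_poly_def sum_distrib_left sum_subtractf[symmetric]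
    using n by (intro sum.cong) (simp_all add: algebra_simps del: smult_pCons)
  then show ?thesis
    unfolding mass using jacobi_poly_orthogonal[of "real \<alpha>" \<beta> k n] assms by simp
qed

section \<open>Moments of the ultraspherical weight\<close>

lemma integral_odd_interval:
  fixes f :: "real \<Rightarrow> real"
  assumes "\<And>x. f (- x) = - f x"
  shows "integral {-1..1} f = 0"
proof -
  have "integral {-1..1} f = integral {-1..1} (\<lambda>x. f (- x))"
    using Henstock_Kurzweil_Integration.integral_reflect_real[of "1" "-1" f] by simp
  also have "\<dots> = - integral {-1..1} f" by (simp add: assms)
  finally show ?thesis by simp
qed

definition beta_integral :: "nat \<Rightarrow> nat \<Rightarrow> real" where
  "beta_integral a k = integral {-1..1} (\<lambda>x. (1 - x\<^sup>2) ^ a * x ^ (2 * k))"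

lemma beta_integral_integrable:
  "(\<lambda>x. (1 - x\<^sup>2) ^ a * x ^ k) integrable_on {-1..1 :: real}"
  by (intro integrable_continuous_interval continuous_intros)

lemma beta_integral_split: "beta_integral (Suc a) k = beta_integral a k - beta_integral a (Suc k)"
proof -
  have "beta_integral a k - beta_integral a (Suc k) =
      integral {-1..1} (\<lambda>x. (1 - x\<^sup>2) ^ a * x ^ (2 * k) - (1 - x\<^sup>2) ^ a * x ^ (2 * Suc k))"
    unfolding beta_integral_def by (intro integral_diff[symmetric] beta_integral_integrable)
  also have "\<dots> = beta_integral (Suc a) k"
    unfolding beta_integral_def by (simp add: algebra_simps power2_eq_square)
  finally show ?thesis by simp
qed

text \<open>
  Integrate the derivative of \<open>(1 - x\<^sup>2)^(a+1) x^(2k+1)\<close>, which vanishes at both endpoints.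
\<close>

lemma beta_integral_by_parts:
  "(2 * real k + 1) * beta_integral (Suc a) k = 2 * (real a + 1) * beta_integral a (Suc k)"
proof -
  let ?f = "\<lambda>x :: real. (2 * real k + 1) * ((1 - x\<^sup>2) ^ Suc a * x ^ (2 * k)) -
     2 * (real a + 1) * ((1 - x\<^sup>2) ^ a * x ^ (2 * Suc k))"
  let ?F = "\<lambda>x :: real. (1 - x\<^sup>2) ^ Suc a * x ^ (2 * k + 1)"
  have "(?f has_integral (?F 1 - ?F (- 1))) {-1..1}"
  proof (rule fundamental_theorem_of_calculus)
    fix x :: real
    have "(?F has_real_derivative ?f x) (at x within {-1..1})"
      by (rule derivative_eq_intros refl | simp)+
        (simp add: algebra_simps power2_eq_square)
    then show "(?F has_vector_derivative ?f x) (at x within {-1..1})"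
      by (simp add: has_real_derivative_iff_has_vector_derivative)
  qed simp
  then have "integral {-1..1} ?f = 0" by (simp add: integral_unique)
  moreover have "integral {-1..1} ?f =
      (2 * real k + 1) * beta_integral (Suc a) k - 2 * (real a + 1) * beta_integral a (Suc k)"
    unfolding beta_integral_def
    by (subst integral_diff)
      (auto intro!: integrable_continuous_interval continuous_intros simp del: power_Suc)
  ultimately show ?thesis by simp
qed

lemma beta_integral_Suc_left:
  "(real a + real k + 3/2) * beta_integral (Suc a) k = (real a + 1) * beta_integral a k"
proof -
  have split: "beta_integral a (Suc k) = beta_integral a k - beta_integral (Suc a) k"
    by (simp add: beta_integral_split)
  show ?thesis
    using beta_integral_by_parts[of k a] unfolding split by (simp add: algebra_simps)
qed

lemma beta_integral_Suc_right:
  "(real a + real k + 3/2) * beta_integral a (Suc k) = (real k + 1/2) * beta_integral a k"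
  using beta_integral_by_parts[of k a] unfolding beta_integral_split by (simp add: algebra_simps)

lemma beta_integral_right:
  "pochhammer (real a + 3/2) k * beta_integral a k = pochhammer (1/2) k * beta_integral a 0"
proof (induction k)
  case (Suc k)
  have "pochhammer (real a + 3/2) (Suc k) * beta_integral a (Suc k) =
      pochhammer (real a + 3/2) k * ((real a + real k + 3/2) * beta_integral a (Suc k))"
    by (simp add: pochhammer_Suc algebra_simps)
  also have "\<dots> = (real k + 1/2) * (pochhammer (real a + 3/2) k * beta_integral a k)"
    unfolding beta_integral_Suc_right by (rule mult.left_commute)
  also have "\<dots> = pochhammer (1/2) (Suc k) * beta_integral a 0"
    unfolding Suc.IH by (simp add: pochhammer_Suc algebra_simps)
  finally show ?case .
qed simp

lemma beta_integral_eq_moment: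
  "beta_integral (\<alpha> + j) k = beta_moment (real \<alpha>) (- 1/2) j k * beta_integral \<alpha> 0"
proof -
  have "pochhammer (real \<alpha> + real k + 3/2) j * beta_integral (\<alpha> + j) k =
      pochhammer (real \<alpha> + 1) j * beta_integral \<alpha> k"
  proof (induction j)
    case (Suc j)
    have "pochhammer (real \<alpha> + real k + 3/2) (Suc j) * beta_integral (\<alpha> + Suc j) k =
        pochhammer (real \<alpha> + real k + 3/2) j *
        ((real (\<alpha> + j) + real k + 3/2) * beta_integral (Suc (\<alpha> + j)) k)"
      by (simp add: pochhammer_Suc algebra_simps)
    also have "\<dots> = (real (\<alpha> + j) + 1) *
        (pochhammer (real \<alpha> + real k + 3/2) j * beta_integral (\<alpha> + j) k)"
      unfolding beta_integral_Suc_left by (rule mult.left_commute)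
    also have "\<dots> = pochhammer (real \<alpha> + 1) (Suc j) * beta_integral \<alpha> k"
      unfolding Suc.IH by (simp add: pochhammer_Suc algebra_simps)
    finally show ?case .
  qed simp
  then have main: "pochhammer (real \<alpha> + 3/2) k *
      (pochhammer (real \<alpha> + real k + 3/2) j * beta_integral (\<alpha> + j) k) =
      pochhammer (real \<alpha> + 1) j * (pochhammer (1/2) k * beta_integral \<alpha> 0)"
    using beta_integral_right[of \<alpha> k] by (simp add: algebra_simps)
  have "pochhammer (real \<alpha> + 3/2) (j + k) =
      pochhammer (real \<alpha> + 3/2) k * pochhammer (real \<alpha> + real k + 3/2) j"
    using pochhammer_product'[of "real \<alpha> + 3/2" k j] by (simp add: algebra_simps)
  then have "pochhammer (real \<alpha> + 3/2) (j + k) * beta_integral (\<alpha> + j) k =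
      pochhammer (real \<alpha> + 1) j * pochhammer (1/2) k * beta_integral \<alpha> 0"
    using main by (simp only: mult.assoc)
  moreover have "pochhammer (real \<alpha> + 3/2) (j + k) > 0" by (intro pochhammer_pos) simp
  ultimately have "beta_integral (\<alpha> + j) k = pochhammer (real \<alpha> + 1) j * pochhammer (1/2) k /
      pochhammer (real \<alpha> + 3/2) (j + k) * beta_integral \<alpha> 0"
    by (simp add: eq_divide_eq mult.commute)
  moreover have "real \<alpha> + (- 1/2) + 2 = real \<alpha> + 3/2" "(- 1/2 :: real) + 1 = 1/2" by simp_all
  ultimately show ?thesis by (simp only: beta_moment_def)
qed

lemma continuous_nonneg_integral_0:
  fixes f :: "real \<Rightarrow> real"
  assumes "continuous_on {-1..1} f" "\<And>x. x \<in> {-1..1} \<Longrightarrow> f x \<ge> 0"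
    "integral {-1..1} f = 0" "x \<in> {-1..1}"
  shows "f x = 0"
  using integral_eq_0_iff[of "-1" 1 f] assms by auto

lemma one_minus_square_nonneg: "x \<in> {-1..1} \<Longrightarrow> 1 - x\<^sup>2 \<ge> (0 :: real)"
  by (simp add: abs_square_le_1 abs_le_iff)

lemma beta_integral_pos: "beta_integral \<alpha> 0 > 0"
proof -
  have "beta_integral \<alpha> 0 \<ge> 0"
    unfolding beta_integral_def
    by (rule integral_nonneg[OF beta_integral_integrable])
      (auto intro!: mult_nonneg_nonneg zero_le_power one_minus_square_nonneg)
  moreover have "beta_integral \<alpha> 0 \<noteq> 0"
  proof
    let ?f = "\<lambda>x :: real. (1 - x\<^sup>2) ^ \<alpha> * x ^ (2 * 0)"
    assume "beta_integral \<alpha> 0 = 0"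
    then have zero: "integral {-1..1} ?f = 0" by (simp add: beta_integral_def)
    have "continuous_on {-1..1} ?f" by (intro continuous_intros)
    then have "?f 0 = 0"
      by (rule continuous_nonneg_integral_0[OF _ _ zero])
        (auto intro!: mult_nonneg_nonneg zero_le_power one_minus_square_nonneg)
    then show False by simp
  qed
  ultimately show ?thesis by simp
qed

lemma ultra_weight_eq: "ultra_weight \<alpha> x = (1 - x\<^sup>2) ^ \<alpha> / beta_integral \<alpha> 0"
  by (simp add: ultra_weight_def beta_integral_def)

lemma ultra_weight_integrable:
  "continuous_on {-1..1} g \<Longrightarrow> (\<lambda>x. g x * ultra_weight \<alpha> x) integrable_on {-1..1}"
  unfolding ultra_weight_eq
  using beta_integral_pos[of \<alpha>]
  by (intro integrable_continuous_interval continuous_intros) auto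

lemma ultra_weight_moment:
  "integral {-1..1} (\<lambda>x. (1 - x\<^sup>2) ^ j * x ^ (2 * k) * ultra_weight \<alpha> x) =
     beta_moment (real \<alpha>) (- 1/2) j k"
proof -
  have "integral {-1..1} (\<lambda>x. (1 - x\<^sup>2) ^ j * x ^ (2 * k) * ultra_weight \<alpha> x) =
      integral {-1..1} (\<lambda>x. (1 - x\<^sup>2) ^ (\<alpha> + j) * x ^ (2 * k) * (1 / beta_integral \<alpha> 0))"
    by (simp add: ultra_weight_eq power_add algebra_simps)
  also have "\<dots> = beta_integral (\<alpha> + j) k / beta_integral \<alpha> 0"
    unfolding beta_integral_def[of "\<alpha> + j"] by (subst integral_mult_left) simp
  finally show ?thesis
    using beta_integral_pos[of \<alpha>] by (simp add: beta_integral_eq_moment)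
qed

lemma integral_ultra_weight_poly:
  assumes "degree q \<le> n"
  shows "integral {-1..1} (\<lambda>x. poly q (1 - x\<^sup>2) * x ^ (2 * k) * ultra_weight \<alpha> x) =
    (\<Sum>j\<le>n. coeff q j * beta_moment (real \<alpha>) (- 1/2) j k)"
proof -
  have "poly q t = (\<Sum>j\<le>n. coeff q j * t ^ j)" for t
    unfolding poly_altdef using assms
    by (intro sum.mono_neutral_left) (auto simp: coeff_eq_0)
  then have "integral {-1..1} (\<lambda>x. poly q (1 - x\<^sup>2) * x ^ (2 * k) * ultra_weight \<alpha> x) =
      integral {-1..1} (\<lambda>x. \<Sum>j\<le>n. coeff q j * ((1 - x\<^sup>2) ^ j * x ^ (2 * k) * ultra_weight \<alpha> x))"
    by (simp add: sum_distrib_right mult.assoc)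
  also have "\<dots> = (\<Sum>j\<le>n. integral {-1..1}
      (\<lambda>x. coeff q j * ((1 - x\<^sup>2) ^ j * x ^ (2 * k) * ultra_weight \<alpha> x)))"
    unfolding mult.assoc[symmetric]
    by (intro integral_sum ultra_weight_integrable) (auto intro!: continuous_intros)
  finally show ?thesis by (simp add: ultra_weight_moment)
qed

section \<open>The inner product with point masses and its orthogonal polynomials\<close>

lemma ultra_type_inner_commute: "ultra_type_inner \<alpha> N p q = ultra_type_inner \<alpha> N q p"
  by (simp add: ultra_type_inner_def mult_ac)

lemma ultra_type_inner_add_right:
  "ultra_type_inner \<alpha> N p (q + r) = ultra_type_inner \<alpha> N p q + ultra_type_inner \<alpha> N p r"
proof -
  have "integral {-1..1} (\<lambda>x. poly p x * poly (q + r) x * ultra_weight \<alpha> x) =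
     integral {-1..1} (\<lambda>x. poly p x * poly q x * ultra_weight \<alpha> x +
       poly p x * poly r x * ultra_weight \<alpha> x)"
    by (simp add: algebra_simps)
  also have "\<dots> = integral {-1..1} (\<lambda>x. poly p x * poly q x * ultra_weight \<alpha> x) +
     integral {-1..1} (\<lambda>x. poly p x * poly r x * ultra_weight \<alpha> x)"
    by (intro integral_add ultra_weight_integrable) (auto intro!: continuous_intros)
  finally show ?thesis by (simp add: ultra_type_inner_def algebra_simps)
qed

lemma ultra_type_inner_smult_right:
  "ultra_type_inner \<alpha> N p (smult c q) = c * ultra_type_inner \<alpha> N p q"
proof -
  have "integral {-1..1} (\<lambda>x. poly p x * poly (smult c q) x * ultra_weight \<alpha> x) =
     integral {-1..1} (\<lambda>x. c * (poly p x * poly q x * ultra_weight \<alpha> x))"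
    by (simp add: algebra_simps)
  then show ?thesis by (simp add: ultra_type_inner_def algebra_simps)
qed

lemma ultra_type_inner_diff_right:
  "ultra_type_inner \<alpha> N p (q - r) = ultra_type_inner \<alpha> N p q - ultra_type_inner \<alpha> N p r"
proof -
  have "q - r = q + smult (- 1) r" by simp
  then show ?thesis
    by (simp only: ultra_type_inner_add_right ultra_type_inner_smult_right)
qed

lemma ultra_type_inner_definite:
  assumes "N \<ge> 0" "ultra_type_inner \<alpha> N p p = 0"
  shows "p = 0"
proof -
  let ?f = "\<lambda>x. poly p x * poly p x * ultra_weight \<alpha> x"
  have pos: "?f x \<ge> 0" if "x \<in> {-1..1}" for x
    using one_minus_square_nonneg[OF that] beta_integral_pos[of \<alpha>]
    by (simp add: ultra_weight_eq)
  have cont: "continuous_on {-1..1} ?f"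
    unfolding ultra_weight_eq using beta_integral_pos[of \<alpha>] by (auto intro!: continuous_intros)
  have "integral {-1..1} ?f \<ge> 0"
    by (rule integral_nonneg[OF integrable_continuous_interval[OF cont] pos])
  moreover have "N * (poly p (-1) * poly p (-1)) \<ge> 0" "N * (poly p 1 * poly p 1) \<ge> 0"
    using assms(1) by auto
  ultimately have zero: "integral {-1..1} ?f = 0"
    using assms(2) unfolding ultra_type_inner_def by linarith
  have "poly p x = 0" if "x \<in> {-1<..<1}" for x
  proof -
    have "?f x = 0"
      using that by (intro continuous_nonneg_integral_0[OF cont pos zero]) auto
    moreover have "1 - x\<^sup>2 \<noteq> 0"
      using that by (auto simp: power2_eq_1_iff)
    ultimately show ?thesis using beta_integral_pos[of \<alpha>] by (simp add: ultra_weight_eq)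
  qed
  then have "{-1<..<1} \<subseteq> {x. poly p x = 0}" by auto
  then have "infinite {x. poly p x = 0}"
    by (rule infinite_super) (simp add: infinite_Ioo)
  then show ?thesis using poly_roots_finite[of p] by blast
qed

lemma ultra_type_inner_opposite_parity:
  assumes "\<And>x. poly p (- x) * poly q (- x) = - (poly p x * poly q x)"
  shows "ultra_type_inner \<alpha> N p q = 0"
proof -
  have "integral {-1..1} (\<lambda>x. poly p x * poly q x * ultra_weight \<alpha> x) = 0"
    by (rule integral_odd_interval) (simp add: assms ultra_weight_def)
  then show ?thesis using assms[of 1] by (simp add: ultra_type_inner_def)
qed

text \<open>
  Vanishing coefficients from \<open>e\<close> on are used in place of a degree bound, so that the zero polynomial
  at \<open>e = 0\<close> needs no separate convention.
\<close>

lemma ultra_type_system_lower_degree: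
  assumes "ultra_type_system \<alpha> N P" "\<And>i. i \<ge> e \<Longrightarrow> coeff r i = 0" "e \<le> d"
  shows "ultra_type_inner \<alpha> N (P d) r = 0"
  using assms(2,3)
proof (induction e arbitrary: r)
  case 0
  then have "r = 0" by (simp add: poly_eq_iff)
  then show ?case using ultra_type_inner_smult_right[of \<alpha> N "P d" 0 0] by simp
next
  case (Suc e)
  have P: "P e \<noteq> 0" "degree (P e) = e" "ultra_type_inner \<alpha> N (P d) (P e) = 0"
    using assms(1) Suc.prems(2) unfolding ultra_type_system_def by auto
  let ?r = "r - smult (coeff r e / lead_coeff (P e)) (P e)"
  have "coeff ?r i = 0" if "i \<ge> e" for i
  proof (cases "i = e")
    case True
    have "coeff (P e) e \<noteq> 0" using P(1,2) leading_coeff_0_iff[of "P e"] by simp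
    then show ?thesis using True P(2) by simp
  next
    case False
    then show ?thesis using that Suc.prems(1) P(2) by (simp add: coeff_eq_0)
  qed
  then have "ultra_type_inner \<alpha> N (P d) ?r = 0"
    by (rule Suc.IH) (use Suc.prems(2) in simp_all)
  then show ?case
    by (simp add: ultra_type_inner_diff_right ultra_type_inner_smult_right P(3))
qed

lemma ultra_type_inner_sum_right:
  "ultra_type_inner \<alpha> N p (\<Sum>i\<in>A. f i) = (\<Sum>i\<in>A. ultra_type_inner \<alpha> N p (f i))"
  using ultra_type_inner_smult_right[of \<alpha> N p 0 0]
  by (induction A rule: infinite_finite_induct) (auto simp: ultra_type_inner_add_right)

text \<open>
  Subtract the multiple of \<open>P\<^sub>d\<close> that removes the leading term of \<open>Q\<close>. The difference has degree below
  \<open>d\<close>, so it is orthogonal to \<open>Q\<close> and to \<open>P\<^sub>d\<close>, hence to itself, and it vanishes by definiteness.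
\<close>

lemma ultra_type_system_unique:
  assumes N: "N \<ge> 0" and P: "ultra_type_system \<alpha> N P" and deg: "degree Q \<le> d"
    and orth: "\<And>i. i < d \<Longrightarrow> ultra_type_inner \<alpha> N Q (monom 1 i) = 0"
    and "poly Q 1 \<noteq> 0"
  shows "poly (P d) 1 / poly Q 1 * poly Q x = poly (P d) x"
proof -
  have Pd: "P d \<noteq> 0" "degree (P d) = d"
    using P unfolding ultra_type_system_def by auto
  define c where "c = coeff Q d / lead_coeff (P d)"
  define r where "r = Q - smult c (P d)"
  have r: "coeff r i = 0" if "i \<ge> d" for i
  proof (cases "i = d")
    case True
    have "coeff (P d) d \<noteq> 0" using Pd leading_coeff_0_iff[of "P d"] by simp
    then show ?thesis using True Pd(2) by (simp add: r_def c_def)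
  next
    case False
    then show ?thesis using that deg Pd(2) by (simp add: r_def coeff_eq_0)
  qed
  have "r = (\<Sum>i<d. smult (coeff r i) (monom 1 i))"
  proof (rule poly_eqI)
    fix j
    have "coeff (\<Sum>i<d. smult (coeff r i) (monom 1 i)) j = (\<Sum>i<d. if i = j then coeff r i else 0)"
      by (simp add: coeff_sum if_distrib cong: if_cong)
    also have "\<dots> = coeff r j" using r[of j] by (simp add: not_less)
    finally show "coeff r j = coeff (\<Sum>i<d. smult (coeff r i) (monom 1 i)) j" by simp
  qed
  then have "ultra_type_inner \<alpha> N Q r = (\<Sum>i<d. coeff r i * ultra_type_inner \<alpha> N Q (monom 1 i))"
    by (metis (no_types, lifting) sum.cong ultra_type_inner_smult_right ultra_type_inner_sum_right)
  then have "ultra_type_inner \<alpha> N Q r = 0" using orth by simp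
  moreover have "ultra_type_inner \<alpha> N (P d) r = 0"
    using ultra_type_system_lower_degree[OF P r order.refl] .
  moreover have "ultra_type_inner \<alpha> N r r =
      ultra_type_inner \<alpha> N r Q - c * ultra_type_inner \<alpha> N r (P d)"
    unfolding r_def by (simp add: ultra_type_inner_diff_right ultra_type_inner_smult_right)
  ultimately have "ultra_type_inner \<alpha> N r r = 0"
    by (simp add: ultra_type_inner_commute)
  then have "r = 0" using ultra_type_inner_definite[OF N] by blast
  then have "Q = smult c (P d)" by (simp add: r_def)
  then show ?thesis using assms(5) by auto
qed

section \<open>Identification of the ultraspherical-type polynomials\<close>

text \<open>
  The image of \<open>q(t)\<close> under \<open>t = 1 - \<xi>\<^sup>2\<close>, with the extra factor \<open>\<xi>\<close> in the odd case.
\<close>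

definition folded_poly :: "nat \<Rightarrow> real poly \<Rightarrow> real poly" where
  "folded_poly \<epsilon> q = [:0, 1:] ^ \<epsilon> * pcompose q [:1, 0, -1:]"

lemma poly_folded_poly: "poly (folded_poly \<epsilon> q) x = x ^ \<epsilon> * poly q (1 - x\<^sup>2)"
  by (simp add: folded_poly_def poly_pcompose poly_power power2_eq_square)

text \<open>
  In the odd case the product of the two factors \<open>\<xi>\<close> is \<open>1 - t\<close>, which raises \<open>\<beta>\<close> from \<open>-1/2\<close> to
  \<open>1/2\<close> and divides the normalized moments by \<open>2\<alpha> + 3\<close>. The two point masses at \<open>\<plusminus>1\<close> merge into
  one of size \<open>2N\<close> at \<open>t = 0\<close>, so relative to the moments the mass becomes \<open>2(2\<alpha> + 3)^\<epsilon> N\<close>.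
\<close>

lemma folded_poly_orthogonal:
  assumes q: "degree q \<le> n" and \<beta>: "\<beta> = real \<epsilon> - 1/2" and \<epsilon>: "\<epsilon> \<le> 1"
    and orth: "\<And>k. k < n \<Longrightarrow> (\<Sum>j\<le>n. coeff q j * beta_moment (real \<alpha>) \<beta> j k) +
        2 * (2 * real \<alpha> + 3) ^ \<epsilon> * N * coeff q 0 = 0"
    and i: "i < 2 * n + \<epsilon>"
  shows "ultra_type_inner \<alpha> N (folded_poly \<epsilon> q) (monom 1 i) = 0"
proof (cases "even (i + \<epsilon>)")
  case False
  then show ?thesis
    by (intro ultra_type_inner_opposite_parity)
      (auto simp: poly_folded_poly poly_monom power_minus' uminus_power_if)
next
  case True
  then obtain k where k: "i = 2 * k + \<epsilon>"
    using \<epsilon> i by (cases "\<epsilon> = 0") (auto elim!: evenE oddE simp: le_Suc_eq)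
  then have kn: "k < n" using i by simp
  have "\<epsilon> + i = 2 * (k + \<epsilon>)" by (simp add: k)
  then have "x ^ \<epsilon> * x ^ i = x ^ (2 * (k + \<epsilon>))" for x :: real
    by (simp only: power_add[symmetric])
  then have "poly (folded_poly \<epsilon> q) x * poly (monom 1 i) x = poly q (1 - x\<^sup>2) * x ^ (2 * (k + \<epsilon>))"
    for x
  proof -
    have "poly (folded_poly \<epsilon> q) x * poly (monom 1 i) x = poly q (1 - x\<^sup>2) * (x ^ \<epsilon> * x ^ i)"
      by (simp add: poly_folded_poly poly_monom)
    then show ?thesis by (simp only: \<open>\<And>x :: real. x ^ \<epsilon> * x ^ i = x ^ (2 * (k + \<epsilon>))\<close>)
  qed
  then have "integral {-1..1} (\<lambda>x. poly (folded_poly \<epsilon> q) x * poly (monom 1 i) x * ultra_weight \<alpha> x) =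
      integral {-1..1} (\<lambda>x. poly q (1 - x\<^sup>2) * x ^ (2 * (k + \<epsilon>)) * ultra_weight \<alpha> x)"
    by (simp only:)
  also have "\<dots> = (\<Sum>j\<le>n. coeff q j * beta_moment (real \<alpha>) (- 1/2) j (k + \<epsilon>))"
    by (rule integral_ultra_weight_poly[OF q])
  finally have int: "integral {-1..1} (\<lambda>x. poly (folded_poly \<epsilon> q) x * poly (monom 1 i) x *
      ultra_weight \<alpha> x) = \<dots>" .
  have moment: "(2 * real \<alpha> + 3) ^ \<epsilon> * beta_moment (real \<alpha>) (- 1/2) j (k + \<epsilon>) =
      beta_moment (real \<alpha>) \<beta> j k" for j
  proof -
    consider "\<epsilon> = 0" | "\<epsilon> = 1" using \<epsilon> by linarith
    then show ?thesis
    proof cases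
      case 2
      have "pochhammer (1/2 :: real) (Suc k) = 1/2 * pochhammer (3/2) k"
        "pochhammer (real \<alpha> + 3/2) (Suc (j + k)) = (real \<alpha> + 3/2) * pochhammer (real \<alpha> + 5/2) (j + k)"
        by (simp_all add: pochhammer_rec add.commute del: pochhammer_Suc)
      moreover have "real \<alpha> + \<beta> + 2 = real \<alpha> + 5/2" "real \<alpha> + (- 1/2) + 2 = real \<alpha> + 3/2"
        "(- 1/2 :: real) + 1 = 1/2" "\<beta> + 1 = 3/2" "j + (k + \<epsilon>) = Suc (j + k)" "k + \<epsilon> = Suc k"
        using 2 \<beta> by simp_all
      ultimately show ?thesis
        unfolding beta_moment_def using 2
        by (simp only:) (simp add: divide_simps del: pochhammer_Suc)
    qed (simp add: \<beta>)
  qed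
  have mass: "poly (folded_poly \<epsilon> q) (- 1) * poly (monom 1 i) (- 1) = coeff q 0"
    "poly (folded_poly \<epsilon> q) 1 * poly (monom 1 i) 1 = coeff q 0"
    by (simp_all add: poly_folded_poly poly_monom k power_add poly_0_coeff_0
        power_mult_distrib[symmetric] mult_ac)
  have "(2 * real \<alpha> + 3) ^ \<epsilon> * ultra_type_inner \<alpha> N (folded_poly \<epsilon> q) (monom 1 i) =
      (\<Sum>j\<le>n. coeff q j * ((2 * real \<alpha> + 3) ^ \<epsilon> * beta_moment (real \<alpha>) (- 1/2) j (k + \<epsilon>))) +
      2 * (2 * real \<alpha> + 3) ^ \<epsilon> * N * coeff q 0"
    unfolding ultra_type_inner_def int mass
    by (simp add: algebra_simps sum_distrib_left)
  also have "\<dots> = 0" unfolding moment by (rule orth[OF kn])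
  finally have "(2 * real \<alpha> + 3) ^ \<epsilon> * ultra_type_inner \<alpha> N (folded_poly \<epsilon> q) (monom 1 i) = 0" .
  moreover have "(2 * real \<alpha> + 3) ^ \<epsilon> \<noteq> 0" by (simp add: add_nonneg_eq_0_iff)
  ultimately show ?thesis by simp
qed

lemma jacobi_type_eq_ultra_type:
  assumes N: "N > 0" and P: "ultra_type_system \<alpha> N P" and \<beta>: "\<beta> = real \<epsilon> - 1/2" and \<epsilon>: "\<epsilon> \<le> 1"
    and K: "K = 2 * (2 * real \<alpha> + 3) ^ \<epsilon> * N"
  shows "\<xi> ^ \<epsilon> * (poly (P (2 * n + \<epsilon>)) 1 / jacobi_type_P \<alpha> \<beta> K n 1 *
     jacobi_type_P \<alpha> \<beta> K n (2 * \<xi>\<^sup>2 - 1)) = poly (P (2 * n + \<epsilon>)) \<xi>"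
proof -
  let ?q = "jacobi_type_poly \<alpha> \<beta> K n"
  let ?Q = "folded_poly \<epsilon> ?q"
  have Q: "poly ?Q x = x ^ \<epsilon> * jacobi_type_P \<alpha> \<beta> K n (2 * x\<^sup>2 - 1)" for x
  proof -
    have "(1 - (2 * x\<^sup>2 - 1)) / 2 = 1 - x\<^sup>2" by (simp add: field_simps)
    then show ?thesis by (simp only: poly_folded_poly jacobi_type_P_eq_poly)
  qed
  have "jacobi_type_P \<alpha> \<beta> K n 1 = pochhammer (real \<alpha> + 1) n / fact n"
    by (simp add: jacobi_type_P_eq_poly poly_0_coeff_0 coeff_0_jacobi_type_poly)
  moreover have "pochhammer (real \<alpha> + 1) n > 0" by (intro pochhammer_pos) simp
  ultimately have "poly ?Q 1 \<noteq> 0" by (simp add: Q)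
  moreover have "degree ?Q \<le> 2 * n + \<epsilon>"
  proof -
    have "degree ?Q \<le> degree ([:0, 1:] ^ \<epsilon> :: real poly) + degree (pcompose ?q [:1, 0, -1:])"
      unfolding folded_poly_def by (rule degree_mult_le)
    then show ?thesis
      using degree_jacobi_type_poly[of \<alpha> \<beta> K n] by (simp add: degree_power_eq degree_pcompose)
  qed
  moreover have "ultra_type_inner \<alpha> N ?Q (monom 1 i) = 0" if "i < 2 * n + \<epsilon>" for i
    using that jacobi_type_poly_orthogonal[of \<beta> _ n \<alpha> K] \<beta>
    by (intro folded_poly_orthogonal[OF degree_jacobi_type_poly \<beta> \<epsilon>]) (auto simp: K)
  ultimately have "poly (P (2 * n + \<epsilon>)) 1 / poly ?Q 1 * poly ?Q \<xi> = poly (P (2 * n + \<epsilon>)) \<xi>"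
    using N P by (intro ultra_type_system_unique) auto
  then show ?thesis by (simp add: Q mult_ac)
qed

text \<open>
  The factor \<open>c\<close> is \<open>2 / 4^(\<alpha>+2)\<close> in the even case and \<open>(4\<alpha>+6) / (4^(\<alpha>+2) \<xi>)\<close> in the odd case.
\<close>

lemma jacobi_type_ultra_type_correspondence:
  fixes \<alpha> \<epsilon> n :: nat and \<beta> N K :: real and P :: "nat \<Rightarrow> real poly"
  assumes N: "N > 0" and P: "ultra_type_system \<alpha> N P"
    and \<beta>: "\<beta> = real \<epsilon> - 1/2" and \<epsilon>: "\<epsilon> \<le> 1"
    and K: "K = 2 * (2 * real \<alpha> + 3) ^ \<epsilon> * N"
  defines "y \<equiv> \<lambda>x. poly (P (2 * n + \<epsilon>)) 1 / jacobi_type_P \<alpha> \<beta> K n 1 * jacobi_type_P \<alpha> \<beta> K n x"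
  shows "(\<forall>\<xi>. \<xi> ^ \<epsilon> * y (2 * \<xi>\<^sup>2 - 1) = poly (P (2 * n + \<epsilon>)) \<xi>) \<and>
    (\<exists>c :: real \<Rightarrow> real. \<forall>\<xi>. 0 < \<xi> \<and> \<xi> < 1 \<longrightarrow>
       c \<xi> \<noteq> 0 \<and>
       jacobi_type_lhs \<alpha> \<beta> K n y (2 * \<xi>\<^sup>2 - 1) =
         c \<xi> * ultra_type_lhs \<alpha> N (2 * n + \<epsilon>) (\<lambda>s. s ^ \<epsilon> * y (2 * s\<^sup>2 - 1)) \<xi> \<and>
       (\<forall>f :: real poly.
          jacobi_type_lhs \<alpha> \<beta> K n (poly f) (2 * \<xi>\<^sup>2 - 1) =
            c \<xi> * ultra_type_lhs \<alpha> N (2 * n + \<epsilon>) (\<lambda>s. s ^ \<epsilon> * poly f (2 * s\<^sup>2 - 1)) \<xi>))"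
proof (intro conjI exI allI impI)
  show "\<xi> ^ \<epsilon> * y (2 * \<xi>\<^sup>2 - 1) = poly (P (2 * n + \<epsilon>)) \<xi>" for \<xi>
    unfolding y_def by (rule jacobi_type_eq_ultra_type[OF N P \<beta> \<epsilon> K])
next
  fix \<xi> :: real
  assume \<xi>: "0 < \<xi> \<and> \<xi> < 1"
  let ?c = "\<lambda>\<xi>. 2 * (2 * real \<alpha> + 3) ^ \<epsilon> / (4 ^ (\<alpha> + 2) * \<xi> ^ \<epsilon>)"
  have "2 * real \<alpha> + 3 > 0" by simp
  then show "?c \<xi> \<noteq> 0" using \<xi> by simp
  show lhs: "jacobi_type_lhs \<alpha> \<beta> K n (poly f) (2 * \<xi>\<^sup>2 - 1) =
      ?c \<xi> * ultra_type_lhs \<alpha> N (2 * n + \<epsilon>) (\<lambda>s. s ^ \<epsilon> * poly f (2 * s\<^sup>2 - 1)) \<xi>" for f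
    using \<xi> by (intro jacobi_type_lhs_eq_ultra_type_lhs \<beta> \<epsilon> K) simp
  let ?g = "smult (poly (P (2 * n + \<epsilon>)) 1 / jacobi_type_P \<alpha> \<beta> K n 1)
      (pcompose (jacobi_type_poly \<alpha> \<beta> K n) [:1/2, - 1/2:])"
  have "y = poly ?g"
    by (simp add: fun_eq_iff y_def jacobi_type_P_eq_poly poly_pcompose diff_divide_distrib)
  then show "jacobi_type_lhs \<alpha> \<beta> K n y (2 * \<xi>\<^sup>2 - 1) =
      ?c \<xi> * ultra_type_lhs \<alpha> N (2 * n + \<epsilon>) (\<lambda>s. s ^ \<epsilon> * y (2 * s\<^sup>2 - 1)) \<xi>"
    by (simp only: lhs)
qed

theorem theorem6p3:
  fixes \<alpha> n :: nat and N :: real and P :: "nat \<Rightarrow> real poly"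
  assumes "N > 0"
    and "ultra_type_system \<alpha> N P"
  shows
    "(let p = poly (P (2 * n)) 1 / jacobi_type_P \<alpha> (- 1 / 2) (2 * N) n 1;
          y = (\<lambda>x. p * jacobi_type_P \<alpha> (- 1 / 2) (2 * N) n x);
          u = (\<lambda>\<xi>. y (2 * \<xi>\<^sup>2 - 1))
      in (\<forall>\<xi>. u \<xi> = poly (P (2 * n)) \<xi>) \<and>
         (\<exists>c :: real \<Rightarrow> real. \<forall>\<xi>. 0 < \<xi> \<and> \<xi> < 1 \<longrightarrow>
            c \<xi> \<noteq> 0 \<and>
            jacobi_type_lhs \<alpha> (- 1 / 2) (2 * N) n y (2 * \<xi>\<^sup>2 - 1) =
              c \<xi> * ultra_type_lhs \<alpha> N (2 * n) u \<xi> \<and>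
            (\<forall>f :: real poly.
               jacobi_type_lhs \<alpha> (- 1 / 2) (2 * N) n (poly f) (2 * \<xi>\<^sup>2 - 1) =
                 c \<xi> * ultra_type_lhs \<alpha> N (2 * n) (\<lambda>s. poly f (2 * s\<^sup>2 - 1)) \<xi>)))
     \<and>
     (let q = poly (P (2 * n + 1)) 1 / jacobi_type_P \<alpha> (1 / 2) ((4 * real \<alpha> + 6) * N) n 1;
          y = (\<lambda>x. q * jacobi_type_P \<alpha> (1 / 2) ((4 * real \<alpha> + 6) * N) n x);
          v = (\<lambda>\<xi>. \<xi> * y (2 * \<xi>\<^sup>2 - 1))
      in (\<forall>\<xi>. v \<xi> = poly (P (2 * n + 1)) \<xi>) \<and>
         (\<exists>c :: real \<Rightarrow> real. \<forall>\<xi>. 0 < \<xi> \<and> \<xi> < 1 \<longrightarrow>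
            c \<xi> \<noteq> 0 \<and>
            jacobi_type_lhs \<alpha> (1 / 2) ((4 * real \<alpha> + 6) * N) n y (2 * \<xi>\<^sup>2 - 1) =
              c \<xi> * ultra_type_lhs \<alpha> N (2 * n + 1) v \<xi> \<and>
            (\<forall>f :: real poly.
               jacobi_type_lhs \<alpha> (1 / 2) ((4 * real \<alpha> + 6) * N) n (poly f) (2 * \<xi>\<^sup>2 - 1) =
                 c \<xi> * ultra_type_lhs \<alpha> N (2 * n + 1) (\<lambda>s. s * poly f (2 * s\<^sup>2 - 1)) \<xi>)))"
  unfolding Let_def
proof (rule conjI, goal_cases)
  case 1
  have "(- 1 / 2 :: real) = real 0 - 1/2" "2 * N = 2 * (2 * real \<alpha> + 3) ^ 0 * N"
    by simp_all
  from jacobi_type_ultra_type_correspondence[OF assms this(1) le0 this(2), of n]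
  show ?case unfolding power_0 mult_1_left add_0_right .
next
  case 2
  have "(1/2 :: real) = real 1 - 1/2" "(4 * real \<alpha> + 6) * N = 2 * (2 * real \<alpha> + 3) ^ 1 * N"
    by (simp_all add: algebra_simps)
  from jacobi_type_ultra_type_correspondence[OF assms this(1) order.refl this(2), of n]
  show ?case unfolding power_one_right .
qed

end
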